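(* Let $X,Y$ be Banach spaces over $\mathbb{K}$ and let $\Phi,\Upsilon,\Psi\in\ell_\infty(B_X,Y)$ with $\|\Phi\|=\|\Upsilon\|=\|\Psi\|=1$. Assume that $Y$ has the $\Phi$-Daugavet property with respect to $Y^*\Upsilon\cdot Y$. If $\mathcal{S}_\Psi<\mathcal{S}_\Upsilon$ (that is, $\Psi$ is strongly slice continuous with respect to $\Upsilon$) and $\Psi$ is weakly compact, then $$\|\Phi+\Psi\|=2.$$
   Context: $\mathbb{K}$ is $\mathbb{R}$ or $\mathbb{C}$, and $\mathbb{T}=\{\omega\in\mathbb{K}:|\omega|=1\}$. $B_X$ is the closed unit ball of $X$, and $Y^*$ is the dual of $Y$. $\ell_\infty(B_X,Y)$ is the space of all bounded (not necessarily linear or continuous) maps $\Phi:B_X\to Y$ with $\|\Phi\|=\sup_{x\in B_X}\|\Phi(x)\|$; $\ell_\infty(B_X)=\ell_\infty(B_X,\mathbb{K})$. For $x'\in\ell_\infty(B_X)$ and $y\in Y$, $x'\otimes y$ is the map $x\mapsto x'(x)y$. For $y^*\in Y^*$, $y^*\Phi=y^*\circ\Phi$, and $Y^*\Upsilon\cdot Y=\{y^*\Upsilon\otimes y: y^*\in Y^*,\ y\in Y\}$. $Y$ has the $\Phi$-Daugavet property with respect to $V\subset\ell_\infty(B_X,Y)$ if $\|\Phi+\Theta\|=\|\Phi\|+\|\Theta\|$ for all $\Theta\in V$. For a function $p:B_X\to\mathbb{K}$ with $\|p\|\le 1$ and $\varepsilon>0$, $S(p,\varepsilon)=\{x\in B_X:\operatorname{Re}p(x)\ge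 1-\varepsilon\}$ (possibly empty). For $y^*\in Y^*$ with $y^*\Phi\ne0$, $\Phi_{y^*}=\frac{1}{\|y^*\Phi\|}\,y^*\Phi:B_X\to\mathbb{K}$. $\mathcal{S}_\Phi=\{S(\Phi_{y^*},\varepsilon):0<\varepsilon<1,\ y^*\in Y^*,\ y^*\Phi\neq0\}$. $\mathcal{S}_\Psi<\mathcal{S}_\Phi$ means: for every $z^*\in Y^*$ with $z^*\Psi\ne0$ and every $0<\varepsilon<1$ there are $y^*\in Y^*$ with $y^*\Phi\neq 0$ and $0<\mu<1$ such that $S(\omega\Phi_{y^*},\mu)\subset S(\omega\Psi_{z^*},\varepsilon)$ for all $\omega\in\mathbb{T}$. $\Psi\in\ell_\infty(B_X,Y)$ is weakly compact if the weak closure of $\Psi(B_X)$ is a weakly compact set. *)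

theory Defs
  imports "HOL-Analysis.Analysis"
begin

text \<open>
  The scalar field is the real or the complex numbers. The class makes this a type parameter: an
  instance is a normed field together with an isometric field embedding into the complex numbers
  whose range is either all of them or the reals.
\<close>

class real_or_complex = real_normed_field +
  fixes to_complex :: "'a \<Rightarrow> complex"
  assumes to_complex_add: "to_complex (x + y) = to_complex x + to_complex y"
    and to_complex_mult: "to_complex (x * y) = to_complex x * to_complex y"
    and to_complex_scaleR: "to_complex (scaleR r x) = scaleR r (to_complex x)"
    and norm_to_complex: "cmod (to_complex x) = norm x"
    and range_to_complex: "range to_complex = \<real> \<or> range to_complex = UNIV"

instantiation real :: real_or_complex
begin

definition to_complex_real :: "real \<Rightarrow> complex"
  where "to_complex_real = complex_of_real"

instance
  by standard (auto simp: to_complex_real_def scaleR_conv_of_real Reals_def)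

end

instantiation complex :: real_or_complex
begin

definition to_complex_complex :: "complex \<Rightarrow> complex"
  where "to_complex_complex = (\<lambda>z. z)"

instance
  by standard (auto simp: to_complex_complex_def)

end

definition re :: "'k::real_or_complex \<Rightarrow> real"
  where "re c = Re (to_complex c)"

text \<open>
  Banach space over the scalar field: completeness and the norm come from the type class, and the
  scalar multiplication \<open>smul\<close> extends the real one.
\<close>

locale banach_space_over = vector_space smul
  for smul :: "'k::real_or_complex \<Rightarrow> 'v::banach \<Rightarrow> 'v" +
  assumes scale_of_real: "smul (of_real r) x = r *\<^sub>R x"
    and norm_scale: "norm (smul c x) = norm c * norm x"

definition dual :: "('k::real_or_complex \<Rightarrow> 'v::banach \<Rightarrow> 'v) \<Rightarrow> ('v \<Rightarrow> 'k) set"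
  where "dual smul = {f. bounded_linear f \<and> (\<forall>c x. f (smul c x) = c * f x)}"

definition weak_topology :: "('k::real_or_complex \<Rightarrow> 'v::banach \<Rightarrow> 'v) \<Rightarrow> 'v topology"
  where "weak_topology smul = topology_generated_by {f -` U | f U. f \<in> dual smul \<and> open U}"

text \<open>
  Maps on the closed unit ball are represented by total functions. All notions below depend only
  on the restriction to \<open>cball 0 1\<close>; in particular a map is nonzero if it has a nonzero value there.
\<close>

definition linf_ball :: "('x::real_normed_vector \<Rightarrow> 'v::real_normed_vector) set"
  where "linf_ball = {\<Phi>. bounded (\<Phi> ` cball 0 1)}"

definition supnorm :: "('x::real_normed_vector \<Rightarrow> 'v::real_normed_vector) \<Rightarrow> real"
  where "supnorm \<Phi> = (SUP x\<in>cball 0 1. norm (\<Phi> x))"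

definition nonzero_on_ball :: "('x::real_normed_vector \<Rightarrow> 'v::real_normed_vector) \<Rightarrow> bool"
  where "nonzero_on_ball \<Phi> \<longleftrightarrow> (\<exists>x\<in>cball 0 1. \<Phi> x \<noteq> 0)"

definition daugavet_wrt ::
    "('x::real_normed_vector \<Rightarrow> 'v::real_normed_vector) \<Rightarrow> ('x \<Rightarrow> 'v) set \<Rightarrow> bool"
  where "daugavet_wrt \<Phi> V \<longleftrightarrow> (\<forall>\<Theta>\<in>V. supnorm (\<lambda>x. \<Phi> x + \<Theta> x) = supnorm \<Phi> + supnorm \<Theta>)"

definition rank_one_maps ::
    "('k::real_or_complex \<Rightarrow> 'v::banach \<Rightarrow> 'v) \<Rightarrow> ('x::real_normed_vector \<Rightarrow> 'v) \<Rightarrow> ('x \<Rightarrow> 'v) set"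
  where "rank_one_maps smul \<Upsilon> = {\<lambda>x. smul (f (\<Upsilon> x)) y | f y. f \<in> dual smul}"

definition slice :: "('x::real_normed_vector \<Rightarrow> 'k::real_or_complex) \<Rightarrow> real \<Rightarrow> 'x set"
  where "slice p \<epsilon> = {x \<in> cball 0 1. re (p x) \<ge> 1 - \<epsilon>}"

definition normalized_comp ::
    "('v \<Rightarrow> 'k::real_or_complex) \<Rightarrow> ('x::real_normed_vector \<Rightarrow> 'v) \<Rightarrow> 'x \<Rightarrow> 'k"
  where "normalized_comp f \<Phi> = (\<lambda>x. (1 / supnorm (f \<circ> \<Phi>)) *\<^sub>R f (\<Phi> x))"

definition strongly_slice_continuous ::
    "('k::real_or_complex \<Rightarrow> 'v::banach \<Rightarrow> 'v) \<Rightarrow> ('x::real_normed_vector \<Rightarrow> 'v) \<Rightarrow> ('x \<Rightarrow> 'v) \<Rightarrow> bool"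
  where "strongly_slice_continuous smul \<Psi> \<Phi> \<longleftrightarrow>
    (\<forall>g\<in>dual smul. nonzero_on_ball (g \<circ> \<Psi>) \<longrightarrow> (\<forall>\<epsilon>. 0 < \<epsilon> \<and> \<epsilon> < 1 \<longrightarrow>
      (\<exists>f\<in>dual smul. nonzero_on_ball (f \<circ> \<Phi>) \<and> (\<exists>\<mu>. 0 < \<mu> \<and> \<mu> < 1 \<and>
        (\<forall>\<omega>\<in>sphere 0 1. slice (\<lambda>x. \<omega> * normalized_comp f \<Phi> x) \<mu>
          \<subseteq> slice (\<lambda>x. \<omega> * normalized_comp g \<Psi> x) \<epsilon>)))))"

definition weakly_compact_map ::
    "('k::real_or_complex \<Rightarrow> 'v::banach \<Rightarrow> 'v) \<Rightarrow> ('x::real_normed_vector \<Rightarrow> 'v) \<Rightarrow> bool"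
  where "weakly_compact_map smul \<Psi> \<longleftrightarrow>
    compactin (weak_topology smul) (weak_topology smul closure_of (\<Psi> ` cball 0 1))"

end

theory Submission
  imports Defs
begin

text \<open>
  A relatively weakly compact set has small slices whose points have nearly maximal norm. Apply this
  to the circled hull of \<open>\<Psi> (cball 0 1)\<close>: some functional \<open>f\<close> and some \<open>q\<close> with \<open>norm q\<close> near \<open>1\<close> are such
  that \<open>\<omega> \<Psi> x\<close> is close to \<open>q\<close> whenever \<open>\<omega> f (\<Psi> x)\<close> is nearly maximal. Strong slice continuity replaces
  this condition by one on a functional \<open>h\<close> of \<open>\<Upsilon>\<close>. By the Daugavet property for the rank one map
  \<open>h \<Upsilon> \<otimes> q\<close>, there is \<open>x\<close> with \<open>norm (\<Phi> x + h (\<Upsilon> x) q)\<close> close to \<open>2\<close>. Then \<open>h (\<Upsilon> x)\<close> has modulus close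
  to \<open>1\<close>, so a rotation puts \<open>x\<close> in the slice, and \<open>h (\<Upsilon> x) q\<close> may be replaced by \<open>\<Psi> x\<close>.

  Small slices need neither Krein's theorem nor extreme points: a minimal weakly closed set with the
  same closed convex hull takes the place of the extreme points in Namioka's Baire category argument.
\<close>

section \<open>Separation of points from closed convex sets\<close>

definition sublinear :: "('a::real_vector \<Rightarrow> real) \<Rightarrow> bool"
  where "sublinear p \<longleftrightarrow>
    (\<forall>x y. p (x + y) \<le> p x + p y) \<and> (\<forall>c\<ge>0. \<forall>x. p (c *\<^sub>R x) = c * p x)"

text \<open>One inequality suffices for positive homogeneity: applying it with
  \<open>inverse c\<close> to \<open>c *\<^sub>R x\<close> gives the reverse one.\<close>

lemma sublinearI:
  fixes p :: "'a::real_vector \<Rightarrow> real"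
  assumes add: "\<And>x y. p (x + y) \<le> p x + p y"
    and scale: "\<And>c x. 0 < c \<Longrightarrow> p (c *\<^sub>R x) \<le> c * p x"
    and zero: "p 0 = 0"
  shows "sublinear p"
  unfolding sublinear_def
proof (intro conjI allI impI)
  fix c :: real and x assume "0 \<le> c"
  show "p (c *\<^sub>R x) = c * p x"
  proof (cases "c = 0")
    case True
    then show ?thesis by (simp add: zero)
  next
    case False
    with \<open>0 \<le> c\<close> have c: "0 < c" by simp
    have "p (inverse c *\<^sub>R (c *\<^sub>R x)) \<le> inverse c * p (c *\<^sub>R x)"
      using c by (intro scale) simp
    then have "c * p x \<le> p (c *\<^sub>R x)"
      using c by (simp add: field_simps)
    then show ?thesis using scale[OF c, of x] by simp
  qed
qed (rule add)

lemma sublinear_add: "sublinear p \<Longrightarrow> p (x + y) \<le> p x + p y"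
  and sublinear_scale: "sublinear p \<Longrightarrow> 0 \<le> c \<Longrightarrow> p (c *\<^sub>R x) = c * p x"
  by (simp_all add: sublinear_def)

lemma sublinear_zero: "sublinear p \<Longrightarrow> p 0 = 0"
  using sublinear_scale[of p 0 0] by simp

lemma sublinear_minus_le: "sublinear p \<Longrightarrow> - p (- x) \<le> p x"
  using sublinear_add[of p x "- x"] by (simp add: sublinear_zero)

text \<open>\<open>r z\<close> is the infimum of \<open>q (z + t *\<^sub>R y) - t * d\<close> over
  \<open>t \<ge> 0\<close> and \<open>y \<in> A\<close>. The bound \<open>d \<le> q y\<close> on
  \<open>A\<close> keeps it finite, convexity of \<open>A\<close> makes it subadditive, and
  \<open>t = 1\<close> at \<open>z = - y\<close> gives the value at most \<open>- d\<close>. A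
  singleton \<open>A\<close> serves for Hahn-Banach, a translate of \<open>- C\<close> for
  separation.\<close>

lemma sublinear_tilt:
  fixes q :: "'a::real_vector \<Rightarrow> real"
  assumes q: "sublinear q" and "convex A" and "A \<noteq> {}" and d: "\<And>y. y \<in> A \<Longrightarrow> d \<le> q y"
  obtains r where "sublinear r" and "\<And>x. r x \<le> q x" and "\<And>y. y \<in> A \<Longrightarrow> r (- y) \<le> - d"
proof -
  define I where "I = {0::real..} \<times> A"
  define h where "h z = (\<lambda>(t, y). q (z + t *\<^sub>R y) - t * d)" for z
  define r where "r z = (INF u\<in>I. h z u)" for z
  have I: "I \<noteq> {}" using assms by (auto simp: I_def)
  have lower: "- q (- z) \<le> h z u" if "u \<in> I" for z u
  proof -
    obtain t y where u: "u = (t, y)" "0 \<le> t" "y \<in> A" using \<open>u \<in> I\<close> by (auto simp: I_def)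
    have "t * d \<le> q (t *\<^sub>R y)" using u d by (simp add: sublinear_scale[OF q] mult_left_mono)
    also have "\<dots> \<le> q (z + t *\<^sub>R y) + q (- z)"
      using sublinear_add[OF q, of "z + t *\<^sub>R y" "- z"] by simp
    finally show ?thesis by (simp add: h_def u)
  qed
  have r_le: "r z \<le> q (z + t *\<^sub>R y) - t * d" if "0 \<le> t" "y \<in> A" for z t y
  proof -
    have "r z \<le> h z (t, y)"
      unfolding r_def using that by (intro cINF_lower bdd_belowI2[OF lower]) (auto simp: I_def)
    then show ?thesis by (simp add: h_def)
  qed
  have le_r: "m \<le> r z" if "\<And>t y. 0 \<le> t \<Longrightarrow> y \<in> A \<Longrightarrow> m \<le> q (z + t *\<^sub>R y) - t * d" for m z
    unfolding r_def by (rule cINF_greatest[OF I]) (auto simp: I_def h_def that)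
  obtain y0 where y0: "y0 \<in> A" using \<open>A \<noteq> {}\<close> by blast
  have r_q: "r x \<le> q x" for x using r_le[of 0 y0 x] y0 by simp
  have "sublinear r"
  proof (rule sublinearI)
    fix x z
    \<comment> \<open>The two infima are taken in turn: first over \<open>(t, y)\<close> with
      \<open>(s, w)\<close> fixed, then over \<open>(s, w)\<close>. The two shifts merge into one
      along the weighted mean \<open>v\<close> of \<open>y\<close> and \<open>w\<close>.\<close>
    have "r (x + z) - (q (z + s *\<^sub>R w) - s * d) \<le> r x" if s: "0 \<le> s" and w: "w \<in> A" for s w
    proof (rule le_r)
      fix t y assume t: "0 \<le> (t::real)" and y: "y \<in> A"
      have "\<exists>v\<in>A. (t + s) *\<^sub>R v = t *\<^sub>R y + s *\<^sub>R w"
      proof (cases "t + s = 0")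
        case True
        then have "t = 0" "s = 0" using t s by auto
        then show ?thesis using y by auto
      next
        case False
        then have "(t / (t + s)) *\<^sub>R y + (s / (t + s)) *\<^sub>R w \<in> A"
          using t s y w \<open>convex A\<close> False
          by (intro convexD) (auto simp flip: add_divide_distrib)
        moreover have "(t + s) *\<^sub>R ((t / (t + s)) *\<^sub>R y + (s / (t + s)) *\<^sub>R w) = t *\<^sub>R y + s *\<^sub>R w"
          using False by (simp add: scaleR_add_right)
        ultimately show ?thesis by blast
      qed
      then obtain v where v: "v \<in> A" "(t + s) *\<^sub>R v = t *\<^sub>R y + s *\<^sub>R w" by blast
      have "r (x + z) \<le> q (x + z + (t + s) *\<^sub>R v) - (t + s) * d"
        using t s v by (intro r_le) auto
      also have "x + z + (t + s) *\<^sub>R v = (x + t *\<^sub>R y) + (z + s *\<^sub>R w)" by (simp add: v)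
      also have "q \<dots> \<le> q (x + t *\<^sub>R y) + q (z + s *\<^sub>R w)" by (rule sublinear_add[OF q])
      finally show "r (x + z) - (q (z + s *\<^sub>R w) - s * d) \<le> q (x + t *\<^sub>R y) - t * d"
        by (simp add: algebra_simps)
    qed
    then have "r (x + z) - r x \<le> r z" by (intro le_r) (simp add: algebra_simps)
    then show "r (x + z) \<le> r x + r z" by simp
  next
    fix c :: real and x assume c: "0 < c"
    have "r (c *\<^sub>R x) / c \<le> r x"
    proof (rule le_r)
      fix t y assume t: "0 \<le> (t::real)" and y: "y \<in> A"
      have "r (c *\<^sub>R x) \<le> q (c *\<^sub>R x + (c * t) *\<^sub>R y) - (c * t) * d"
        using t c y by (intro r_le) auto
      also have "c *\<^sub>R x + (c * t) *\<^sub>R y = c *\<^sub>R (x + t *\<^sub>R y)" by (simp add: algebra_simps)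
      also have "q \<dots> = c * q (x + t *\<^sub>R y)" using c by (simp add: sublinear_scale[OF q])
      finally show "r (c *\<^sub>R x) / c \<le> q (x + t *\<^sub>R y) - t * d"
        using c by (simp add: field_simps)
    qed
    then show "r (c *\<^sub>R x) \<le> c * r x" using c by (simp add: field_simps)
  next
    have "0 \<le> r 0" by (rule le_r) (simp add: sublinear_scale[OF q] mult_left_mono d)
    then show "r 0 = 0" using r_q[of 0] by (simp add: sublinear_zero[OF q])
  qed
  moreover have "r (- y) \<le> - d" if "y \<in> A" for y
    using r_le[of 1 y "- y"] that by (simp add: sublinear_zero[OF q])
  ultimately show thesis using r_q that by blast
qed

text \<open>Zorn's lemma for the reversed pointwise order. A chain has its pointwise infimum as
  lower bound, finite because every member is at least \<open>- p (- x)\<close> at \<open>x\<close>.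
  The infimum is subadditive because any two members lie above a common member of the chain.\<close>

lemma sublinear_minimal:
  fixes p :: "'a::real_vector \<Rightarrow> real"
  assumes p: "sublinear p"
  obtains q where "sublinear q" and "\<And>x. q x \<le> p x"
    and "\<And>r. sublinear r \<Longrightarrow> (\<And>x. r x \<le> q x) \<Longrightarrow> r = q"
proof -
  define S where "S = {q. sublinear q \<and> q \<le> p}"
  define ge where "ge a b \<longleftrightarrow> b \<le> a" for a b :: "'a \<Rightarrow> real"
  have "\<exists>m\<in>S. \<forall>a\<in>S. ge m a \<longrightarrow> a = m"
  proof (rule predicate_Zorn)
    show "partial_order_on S (relation_of ge S)"
      by (auto simp: partial_order_on_def preorder_on_def refl_on_def trans_def antisym_def
          relation_of_def ge_def intro: order_trans)
  next
    fix C assume "C \<in> Chains (relation_of ge S)"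
    then have sub: "C \<subseteq> S" and chain: "\<And>a b. a \<in> C \<Longrightarrow> b \<in> C \<Longrightarrow> a \<le> b \<or> b \<le> a"
      by (auto simp: Chains_def relation_of_def ge_def)
    show "\<exists>u\<in>S. \<forall>a\<in>C. ge a u"
    proof (cases "C = {}")
      case True
      then show ?thesis using p by (auto simp: S_def)
    next
      case False
      define u where "u x = (INF q\<in>C. q x)" for x
      have lower: "- p (- x) \<le> q x" if "q \<in> C" for q x
      proof -
        have "sublinear q" "q (- x) \<le> p (- x)" using that sub by (auto simp: S_def le_fun_def)
        then show ?thesis using sublinear_minus_le[of q x] by simp
      qed
      have u_le: "u x \<le> q x" if "q \<in> C" for q x
        unfolding u_def using that by (intro cINF_lower bdd_belowI2[OF lower])
      have le_u: "m \<le> u x" if "\<And>q. q \<in> C \<Longrightarrow> m \<le> q x" for m x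
        unfolding u_def by (rule cINF_greatest[OF False that])
      have sl: "sublinear q" if "q \<in> C" for q using that sub by (auto simp: S_def)
      have "sublinear u"
      proof (rule sublinearI)
        fix x y
        have "u (x + y) - a x \<le> b y" if ab: "a \<in> C" "b \<in> C" for a b
        proof -
          obtain c where c: "c \<in> C" "c \<le> a" "c \<le> b" using chain[OF ab] ab by auto
          have "u (x + y) \<le> c x + c y"
            using u_le[OF c(1)] sublinear_add[OF sl[OF c(1)]] by (rule order_trans)
          then show ?thesis using le_funD[OF c(2), of x] le_funD[OF c(3), of y] by simp
        qed
        then have "u (x + y) - a x \<le> u y" if "a \<in> C" for a using that by (intro le_u)
        then have "u (x + y) - u y \<le> u x" by (intro le_u) (simp add: algebra_simps)
        then show "u (x + y) \<le> u x + u y" by simp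
      next
        fix c :: real and x assume c: "0 < c"
        have "u (c *\<^sub>R x) / c \<le> u x"
        proof (rule le_u)
          fix q assume q: "q \<in> C"
          show "u (c *\<^sub>R x) / c \<le> q x"
            using u_le[OF q, of "c *\<^sub>R x"] c sublinear_scale[OF sl[OF q], of c x]
            by (simp add: field_simps)
        qed
        then show "u (c *\<^sub>R x) \<le> c * u x" using c by (simp add: field_simps)
      next
        obtain q where "q \<in> C" using False by blast
        then have "u 0 \<le> 0" using u_le[of q 0] sl sublinear_zero by fastforce
        moreover have "0 \<le> u 0" by (rule le_u) (simp add: sublinear_zero sl)
        ultimately show "u 0 = 0" by simp
      qed
      moreover have "u \<le> p"
      proof -
        obtain q where "q \<in> C" using False by blast
        then show ?thesis using u_le[of q] sub by (auto simp: S_def le_fun_def intro: order_trans)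
      qed
      ultimately show ?thesis using u_le by (auto simp: S_def ge_def le_fun_def)
    qed
  qed
  then obtain m where m: "m \<in> S" "\<And>a. a \<in> S \<Longrightarrow> a \<le> m \<Longrightarrow> a = m" by (auto simp: ge_def)
  show thesis
  proof (rule that[of m])
    show "sublinear m" using m by (simp add: S_def)
    show "m x \<le> p x" for x using m by (simp add: S_def le_fun_def)
    fix r :: "'a \<Rightarrow> real" assume "sublinear r" "\<And>x. r x \<le> m x"
    moreover from this have "r \<le> m" by (simp add: le_funI)
    moreover have "m \<le> p" using m by (simp add: S_def)
    ultimately show "r = m" using m(2)[of r] by (simp add: S_def)
  qed
qed

text \<open>
  A pointwise minimal sublinear functional is additive: tilting it along a single vector \<open>y\<close>
  cannot decrease it.
\<close>

lemma hahn_banach_dominated: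
  fixes p :: "'a::real_vector \<Rightarrow> real"
  assumes "sublinear p"
  obtains g where "linear g" and "\<And>x. g x \<le> p x"
proof -
  obtain q where q: "sublinear q" "\<And>x. q x \<le> p x"
    and min: "\<And>r. sublinear r \<Longrightarrow> (\<And>x. r x \<le> q x) \<Longrightarrow> r = q"
    using sublinear_minimal[OF assms] by metis
  have neg: "q (- y) = - q y" for y
  proof -
    obtain r where r: "sublinear r" "\<And>x. r x \<le> q x" "r (- y) \<le> - q y"
      using sublinear_tilt[OF q(1), of "{y}" "q y"] by auto
    then have "r = q" by (intro min)
    then show ?thesis using r(3) sublinear_minus_le[OF q(1), of "- y"] by simp
  qed
  have add: "q (x + y) = q x + q y" for x y
    using sublinear_add[OF q(1), of x y] sublinear_add[OF q(1), of "- x" "- y"] neg[of "x + y"]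
    by (simp add: neg)
  have "q (c *\<^sub>R x) = c * q x" for c x
  proof (cases "0 \<le> c")
    case True
    then show ?thesis by (rule sublinear_scale[OF q(1)])
  next
    case False
    then show ?thesis using sublinear_scale[OF q(1), of "- c" x] by (simp add: neg)
  qed
  then have "linear q" using add by (intro linearI) auto
  then show thesis using that q(2) by blast
qed

text \<open>The set \<open>x - C\<close> keeps the distance \<open>d > 0\<close> from the origin, so
  the norm can be tilted along it. A linear \<open>g\<close> below the tilted norm is bounded by the
  norm, and \<open>g (y - x) \<le> - d\<close> on \<open>C\<close> is the separation.\<close>

lemma separate_point_closed_convex:
  fixes C :: "'a::real_normed_vector set"
  assumes "closed C" and "convex C" and "x \<notin> C"
  shows "\<exists>g c. bounded_linear g \<and> c < g x \<and> (\<forall>y\<in>C. g y \<le> (c::real))"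
proof (cases "C = {}")
  case True
  then show ?thesis by (intro exI[of _ "\<lambda>_. 0"] exI[of _ "-1"]) simp
next
  case False
  define A where "A = (\<lambda>y. x - y) ` C"
  define d where "d = infdist x C"
  have d: "0 < d"
    using assms False in_closed_iff_infdist_zero[of C x] infdist_nonneg[of x C] by (auto simp: d_def)
  have "A = (+) x ` uminus ` C" by (auto simp: A_def image_image)
  then have A: "convex A" "A \<noteq> {}"
    using assms False by (simp_all add: convex_translation convex_negations)
  have A_norm: "d \<le> norm y" if "y \<in> A" for y
    using that infdist_le[of _ C x] by (auto simp: A_def d_def dist_norm)
  obtain r where r: "sublinear r" "\<And>z. r z \<le> norm z" "\<And>y. y \<in> A \<Longrightarrow> r (- y) \<le> - d"
    by (rule sublinear_tilt[of norm A d])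
       (auto simp: A A_norm sublinear_def norm_triangle_ineq)
  obtain g where g: "linear g" "\<And>z. g z \<le> r z"
    using hahn_banach_dominated[OF r(1)] by metis
  have g_le: "g z \<le> norm z" for z using g(2) r(2) order_trans by blast
  have "bounded_linear g"
  proof (rule bounded_linear_intro[where K = 1])
    show "norm (g z) \<le> norm z * 1" for z
      using g_le[of z] g_le[of "- z"] by (simp add: linear_neg[OF g(1)] abs_le_iff)
  qed (use g(1) in \<open>simp_all add: linear_add linear_cmul\<close>)
  moreover have "g y \<le> g x - d" if "y \<in> C" for y
  proof -
    have "r (- (x - y)) \<le> - d" using that by (intro r(3)) (auto simp: A_def)
    then have "g (- (x - y)) \<le> - d" using g(2) order_trans by blast
    then show ?thesis by (simp add: linear_diff[OF g(1)])
  qed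
  ultimately show ?thesis using d by (intro exI[of _ g] exI[of _ "g x - d"]) simp
qed

section \<open>The weak topology\<close>

text \<open>
  Taking \<open>scaleR\<close> as scalar multiplication in \<^const>\<open>weak_topology\<close> gives the weak topology of the
  underlying real Banach space.
\<close>

abbreviation weak_real :: "'v::banach topology"
  where "weak_real \<equiv> weak_topology (scaleR :: real \<Rightarrow> 'v \<Rightarrow> 'v)"

lemma topspace_weak_topology [simp]: "topspace (weak_topology smul) = UNIV"
proof -
  have "(\<lambda>_. 0) \<in> dual smul" by (simp add: dual_def)
  then have "(\<lambda>_. 0) -` UNIV \<in> {f -` U | f U. f \<in> dual smul \<and> open U}" using open_UNIV by blast
  then show ?thesis unfolding weak_topology_def topology_generated_by_topspace by auto
qed

lemma dual_scaleR: "dual scaleR = {g :: 'v::banach \<Rightarrow> real. bounded_linear g}"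
  by (auto simp: dual_def bounded_linear.linear linear_cmul)

lemma openin_weak_topology_vimage:
  "f \<in> dual smul \<Longrightarrow> open U \<Longrightarrow> openin (weak_topology smul) (f -` U)"
  unfolding weak_topology_def by (rule topology_generated_by_Basis) blast

lemma continuous_map_into_weak_topology:
  "continuous_map T (weak_topology smul) h"
  if "\<And>f. f \<in> dual smul \<Longrightarrow> continuous_map T euclidean (f \<circ> h)"
  unfolding weak_topology_def
proof (rule continuous_on_generated_topo)
  fix W assume "W \<in> {f -` U | f U. f \<in> dual smul \<and> open U}"
  then obtain f U where W: "W = f -` U" "f \<in> dual smul" "open U" by blast
  have "openin T {x \<in> topspace T. (f \<circ> h) x \<in> U}"
    using that[OF W(2)] W(3) by (intro openin_continuous_map_preimage[where Y = euclidean]) (simp_all add: comp_def)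
  also have "{x \<in> topspace T. (f \<circ> h) x \<in> U} = h -` W \<inter> topspace T" by (auto simp: W)
  finally show "openin T (h -` W \<inter> topspace T)" .
next
  have "\<Union> {f -` U | f U. f \<in> dual smul \<and> open U} = topspace (weak_topology smul)"
    unfolding weak_topology_def topology_generated_by_topspace ..
  then show "h ` topspace T \<subseteq> \<Union> {f -` U | f U. f \<in> dual smul \<and> open U}" by simp
qed

lemma continuous_map_weak_topology_dual:
  "f \<in> dual smul \<Longrightarrow> continuous_map (weak_topology smul) euclidean f"
  using openin_weak_topology_vimage[of f smul]
  by (auto simp: continuous_map_def vimage_def)

lemma openin_weak_real_halfspace:
  fixes g :: "'v::banach \<Rightarrow> real"
  shows "bounded_linear g \<Longrightarrow> openin weak_real {z. c < g z}"
  using openin_weak_topology_vimage[of g scaleR "{c<..}"] by (simp add: dual_scaleR vimage_def)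

lemma closedin_weak_real_halfspace:
  fixes g :: "'v::banach \<Rightarrow> real"
  shows "bounded_linear g \<Longrightarrow> closedin weak_real {z. c \<le> g z}"
proof -
  assume "bounded_linear g"
  then have "openin weak_real (g -` {..<c})"
    by (intro openin_weak_topology_vimage) (simp_all add: dual_scaleR)
  moreover have "UNIV - {z. c \<le> g z} = g -` {..<c}" by auto
  ultimately show ?thesis by (simp add: closedin_def)
qed

text \<open>Mazur's theorem: separation puts each outside point into an open half-space that misses
  \<open>C\<close>.\<close>

lemma closedin_weak_real_convex:
  fixes C :: "'v::banach set"
  assumes "closed C" and "convex C"
  shows "closedin weak_real C"
proof -
  have "\<exists>U. openin weak_real U \<and> x \<in> U \<and> U \<subseteq> - C" if "x \<notin> C" for x
  proof -
    obtain g :: "'v \<Rightarrow> real" and c where g: "bounded_linear g" "c < g x" "\<forall>y\<in>C. g y \<le> c"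
      using separate_point_closed_convex[OF assms \<open>x \<notin> C\<close>] by blast
    then have "x \<in> {z. c < g z}" "{z. c < g z} \<subseteq> - C" by force+
    then show ?thesis using openin_weak_real_halfspace[OF g(1)] by blast
  qed
  then have "openin weak_real (- C)" using openin_subopen[of weak_real "- C"] by auto
  then show ?thesis by (simp add: closedin_def Compl_eq_Diff_UNIV)
qed

text \<open>Makes weakly compact sets weakly closed and regular, as Zorn's lemma and Baire's theorem
  require below.\<close>

lemma Hausdorff_weak_real: "Hausdorff_space (weak_real :: 'v::banach topology)"
  unfolding Hausdorff_space_def
proof (intro allI impI, clarsimp)
  fix x y :: 'v assume "x \<noteq> y"
  then obtain g :: "'v \<Rightarrow> real" and c where g: "bounded_linear g" "c < g x" "g y \<le> c"
    using separate_point_closed_convex[of "{y}" x] by auto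
  obtain d where d: "c < d" "d < g x" using g dense by blast
  have neg: "bounded_linear (\<lambda>z. - g z)" by (rule bounded_linear_minus[OF g(1)])
  have "openin weak_real {z. d < g z}" "openin weak_real {z. - d < - g z}"
    using openin_weak_real_halfspace g(1) neg by blast+
  moreover have "x \<in> {z. d < g z}" "y \<in> {z. - d < - g z}" "disjnt {z. d < g z} {z. - d < - g z}"
    using d g by (auto simp: disjnt_iff)
  ultimately show "\<exists>U. openin weak_real U \<and> (\<exists>V. openin weak_real V \<and> x \<in> U \<and> y \<in> V \<and> disjnt U V)"
    by blast
qed

section \<open>Small slices of countable sets\<close>

text \<open>Finite combinations with rational coefficients, coded as lists so that concatenation is
  addition. Their closure is a subspace containing \<open>D\<close>. They provide the centres of the
  countably many balls in the Baire argument.\<close>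

lemma countable_dense_in_span:
  fixes D :: "'a::real_normed_vector set"
  assumes "countable D"
  obtains Q where "countable Q" and "span D \<subseteq> closure Q"
proof -
  define val where "val l = (\<Sum>(r, x)\<leftarrow>l. of_rat r *\<^sub>R x)" for l :: "(rat \<times> 'a) list"
  define L where "L = lists ((UNIV :: rat set) \<times> D)"
  define Q where "Q = val ` L"
  have "countable Q" unfolding Q_def L_def using assms by (intro countable_image countable_lists) auto
  have Q_add: "x + y \<in> Q" if "x \<in> Q" "y \<in> Q" for x y
  proof -
    obtain l m where lm: "l \<in> L" "m \<in> L" "x = val l" "y = val m"
      using \<open>x \<in> Q\<close> \<open>y \<in> Q\<close> by (auto simp: Q_def)
    then have "x + y = val (l @ m)" "l @ m \<in> L" by (simp_all add: val_def L_def)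
    then show ?thesis by (simp add: Q_def)
  qed
  have Q_scale: "of_rat r *\<^sub>R x \<in> Q" if "x \<in> Q" for r x
  proof -
    have "of_rat r *\<^sub>R val l = val (map (\<lambda>(s, x). (r * s, x)) l)" for l
      by (induction l) (auto simp: val_def scaleR_add_right of_rat_mult)
    moreover obtain l where l: "l \<in> L" "x = val l" using \<open>x \<in> Q\<close> by (auto simp: Q_def)
    moreover have "map (\<lambda>(s, x). (r * s, x)) l \<in> L" using l by (auto simp: L_def)
    ultimately show ?thesis by (auto simp: Q_def)
  qed
  have Q_scaleR: "c *\<^sub>R x \<in> closure Q" if "x \<in> Q" for c x
    unfolding closure_approachable
  proof (intro allI impI)
    fix e :: real assume "0 < e"
    \<comment> \<open>The summand \<open>1\<close> covers \<open>x = 0\<close>.\<close>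
    define d where "d = e / (norm x + 1)"
    have pos: "0 < norm x + 1" by (simp add: add_nonneg_pos)
    then have "0 < d" using \<open>0 < e\<close> by (simp add: d_def)
    then obtain r where r: "c - d < of_rat r" "of_rat r < c + d"
      using of_rat_dense[of "c - d" "c + d"] by auto
    have "dist (of_rat r *\<^sub>R x) (c *\<^sub>R x) = \<bar>of_rat r - c\<bar> * norm x"
      by (simp add: dist_norm flip: scaleR_diff_left)
    also have "\<dots> \<le> d * norm x" using r by (intro mult_right_mono) auto
    also have "\<dots> < e" using \<open>0 < e\<close> pos by (simp add: d_def pos_divide_less_eq distrib_left)
    finally show "\<exists>y\<in>Q. dist y (c *\<^sub>R x) < e" using Q_scale[OF that] by blast
  qed
  have "subspace (closure Q)"
  proof (rule subspaceI)
    have "val [] \<in> Q" unfolding Q_def by (rule imageI) (simp add: L_def)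
    then show "0 \<in> closure Q" using closure_subset by (auto simp: val_def)
  next
    fix x y assume "x \<in> closure Q" "y \<in> closure Q"
    then obtain u v where uv: "\<And>n. u n \<in> Q" "u \<longlonglongrightarrow> x" "\<And>n. v n \<in> Q" "v \<longlonglongrightarrow> y"
      unfolding closure_sequential by blast
    then have "(\<lambda>n. u n + v n) \<longlonglongrightarrow> x + y" "\<And>n. u n + v n \<in> Q"
      by (auto intro: tendsto_add Q_add)
    then show "x + y \<in> closure Q"
      unfolding closure_sequential by (auto intro!: exI[of _ "\<lambda>n. u n + v n"])
  next
    fix c x assume "x \<in> closure Q"
    then have "c *\<^sub>R x \<in> closure ((*\<^sub>R) c ` Q)" unfolding closure_scaleR[symmetric] by (rule imageI)
    also have "\<dots> \<subseteq> closure (closure Q)" using Q_scaleR by (intro closure_mono) auto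
    finally show "c *\<^sub>R x \<in> closure Q" by simp
  qed
  moreover have "D \<subseteq> closure Q"
  proof
    fix x assume "x \<in> D"
    then have "val [(1, x)] \<in> Q" unfolding Q_def by (intro imageI) (simp add: L_def)
    then show "x \<in> closure Q" using closure_subset by (auto simp: val_def)
  qed
  ultimately have "span D \<subseteq> closure Q" by (intro span_minimal)
  then show thesis using \<open>countable Q\<close> that by blast
qed

text \<open>For weakly compact \<open>F\<close> this means that \<open>D\<close> lies in the closed
  convex hull of \<open>F\<close>. Stated through attained values, it passes to intersections of
  chains by compactness, and its failure directly yields a functional.\<close>

definition dominates :: "'v::real_normed_vector set \<Rightarrow> 'v set \<Rightarrow> bool"
  where "dominates F D \<longleftrightarrow>
    (\<forall>g :: 'v \<Rightarrow> real. bounded_linear g \<longrightarrow> (\<forall>x\<in>D. \<exists>y\<in>F. g x \<le> g y))"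

lemma dominates_hull:
  assumes "dominates F D" and "closed C" and "convex C" and "F \<subseteq> C"
  shows "D \<subseteq> C"
proof
  fix x assume "x \<in> D"
  show "x \<in> C"
  proof (rule ccontr)
    assume "x \<notin> C"
    then obtain g :: "_ \<Rightarrow> real" and c where g: "bounded_linear g" "c < g x" "\<forall>y\<in>C. g y \<le> c"
      using separate_point_closed_convex[OF assms(2,3)] by blast
    then show False using \<open>x \<in> D\<close> assms(1,4) unfolding dominates_def by fastforce
  qed
qed

text \<open>Zorn's lemma for reversed inclusion. The minimal set stands in for the closure of the
  extreme points.\<close>

lemma dominates_minimal:
  fixes H :: "'v::banach set"
  assumes H: "compactin weak_real H" and dom: "dominates H D"
  obtains F where "F \<subseteq> H" and "closedin weak_real F" and "dominates F D"
    and "\<And>G. G \<subseteq> F \<Longrightarrow> closedin weak_real G \<Longrightarrow> dominates G D \<Longrightarrow> G = F"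
proof -
  define S where "S = {F. F \<subseteq> H \<and> closedin weak_real F \<and> dominates F D}"
  have "H \<in> S" using H dom compactin_imp_closedin[OF Hausdorff_weak_real] by (auto simp: S_def)
  have "\<exists>m\<in>S. \<forall>a\<in>S. m \<supseteq> a \<longrightarrow> a = m"
  proof (rule predicate_Zorn)
    show "partial_order_on S (relation_of (\<supseteq>) S)"
      by (auto simp: partial_order_on_def preorder_on_def refl_on_def trans_def antisym_def
          relation_of_def)
  next
    fix C assume "C \<in> Chains (relation_of (\<supseteq>) S)"
    then have sub: "C \<subseteq> S" and chain: "\<And>a b. a \<in> C \<Longrightarrow> b \<in> C \<Longrightarrow> a \<subseteq> b \<or> b \<subseteq> a"
      by (auto simp: Chains_def relation_of_def)
    show "\<exists>u\<in>S. \<forall>a\<in>C. u \<subseteq> a"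
    proof (cases "C = {}")
      case True
      then show ?thesis using \<open>H \<in> S\<close> by auto
    next
      case False
      have finite_lower: "\<exists>c\<in>C. c \<subseteq> \<Inter>\<F>" if "finite \<F>" "\<F> \<subseteq> C" for \<F>
        using that
      proof (induction \<F>)
        case empty
        then show ?case using False by auto
      next
        case (insert a \<F>)
        then obtain c where c: "c \<in> C" "c \<subseteq> \<Inter>\<F>" by auto
        then show ?case using chain[of a c] insert.prems by auto
      qed
      have "dominates (\<Inter>C) D"
        unfolding dominates_def
      proof (intro allI impI ballI)
        fix g :: "'v \<Rightarrow> real" and x assume g: "bounded_linear g" and "x \<in> D"
        define Z where "Z = {z. g x \<le> g z}"
        \<comment> \<open>Each member of the chain meets the half-space \<open>Z\<close>, and
          finitely many members contain a common one. The finite intersection property therefore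
          yields a point of \<open>Z\<close> common to the whole chain.\<close>
        have "H \<inter> \<Inter>(insert Z C) \<noteq> {}"
        proof (rule compactin_fip[THEN iffD1, OF H, THEN conjunct2, rule_format], intro conjI ballI allI impI)
          fix a assume "a \<in> insert Z C"
          then show "closedin weak_real a"
            using sub closedin_weak_real_halfspace[OF g] by (auto simp: S_def Z_def)
        next
          fix \<F> assume \<F>: "finite \<F> \<and> \<F> \<subseteq> insert Z C"
          then obtain c where c: "c \<in> C" "c \<subseteq> \<Inter>(\<F> - {Z})" using finite_lower[of "\<F> - {Z}"] by auto
          then have "dominates c D" "c \<subseteq> H" using sub by (auto simp: S_def)
          then obtain y where y: "y \<in> c" "g x \<le> g y" using g \<open>x \<in> D\<close> unfolding dominates_def by blast
          then have "y \<in> H \<inter> \<Inter>\<F>" using c \<open>c \<subseteq> H\<close> by (auto simp: Z_def)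
          then show "H \<inter> \<Inter>\<F> \<noteq> {}" by blast
        qed
        then show "\<exists>y\<in>\<Inter>C. g x \<le> g y" by (auto simp: Z_def)
      qed
      moreover have "closedin weak_real (\<Inter>C)" using False sub by (intro closedin_Inter) (auto simp: S_def)
      moreover have "\<Inter>C \<subseteq> H" using False sub by (auto simp: S_def)
      ultimately have "\<Inter>C \<in> S" by (simp add: S_def)
      then show ?thesis by blast
    qed
  qed
  then obtain F where "F \<in> S" "\<forall>a\<in>S. a \<subseteq> F \<longrightarrow> a = F" by blast
  then show thesis using that[of F] by (auto simp: S_def)
qed

text \<open>
  By Baire's theorem a minimal dominating weakly closed set \<open>F\<close> has a relatively weakly open part
  \<open>W\<close> inside a small norm ball. By minimality some functional separates \<open>F - W\<close> from a point of
  \<open>D\<close>, and this functional defines the slice. That the slice is small follows by applying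
  \<open>dominates_hull\<close> to a sublevel set of the convex function \<open>z \<Rightarrow> norm (z - q) + K * g z\<close>.
\<close>

lemma countable_small_slice:
  fixes D :: "'v::banach set"
  assumes H: "compactin weak_real H" and "D \<subseteq> H" and "countable D" and "bounded D"
    and x0: "x0 \<in> D" "\<rho> + 3 * r < norm x0" and "0 \<le> \<rho>" and "0 < r"
  shows "\<exists>(g :: 'v \<Rightarrow> real) \<beta> q. bounded_linear g \<and> \<rho> + r < norm q \<and> (\<exists>x\<in>D. \<beta> < g x) \<and>
    (\<forall>x\<in>D. \<beta> < g x \<longrightarrow> norm (x - q) \<le> 2 * r)"
proof -
  \<comment> \<open>Choosing \<open>F\<close> inside \<open>K0\<close> keeps it bounded and within
    the closure of a countable set.\<close>
  define K0 where "K0 = closure (convex hull D)"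
  have "bounded K0" using \<open>bounded D\<close> by (simp add: K0_def bounded_convex_hull bounded_closure)
  have "D \<subseteq> K0" unfolding K0_def by (rule order_trans[OF hull_subset closure_subset])
  have K0_min: "K0 \<subseteq> C" if "closed C" "convex C" "D \<subseteq> C" for C
    unfolding K0_def using that by (intro closure_minimal hull_minimal)
  have "closedin weak_real K0"
    by (intro closedin_weak_real_convex) (simp_all add: K0_def convex_closure)
  then have "compactin weak_real (K0 \<inter> H)" using H by (rule closed_Int_compactin)
  moreover have "dominates (K0 \<inter> H) D"
    using \<open>D \<subseteq> K0\<close> \<open>D \<subseteq> H\<close> by (auto simp: dominates_def)
  ultimately obtain F where F: "F \<subseteq> K0 \<inter> H" "closedin weak_real F" "dominates F D"
    and F_min: "\<And>G. G \<subseteq> F \<Longrightarrow> closedin weak_real G \<Longrightarrow> dominates G D \<Longrightarrow> G = F"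
    using dominates_minimal by metis
  have F_compact: "compactin weak_real F" using F H by (blast intro: closed_compactin)
  obtain Q where Q: "countable Q" "span D \<subseteq> closure Q"
    using countable_dense_in_span[OF \<open>countable D\<close>] by metis
  have "K0 \<subseteq> closure (closure Q)"
    unfolding K0_def using Q(2) convex_hull_subset_span by (intro closure_mono) blast
  then have "F \<subseteq> closure Q" using F by auto

  define T where "T = subtopology weak_real F"
  have "compact_space T" "Hausdorff_space T"
    using F_compact Hausdorff_space_subtopology[OF Hausdorff_weak_real]
    by (simp_all add: T_def compact_space_subtopology)
  then have Baire: "locally_compact_space T \<and> regular_space T"
    using compact_imp_locally_compact_space compact_Hausdorff_imp_regular_space by blast
  have cball: "closedin T (F \<inter> cball q s)" for q s
    unfolding T_def by (intro closedin_subtopology_Int_closed closedin_weak_real_convex) auto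
  \<comment> \<open>Points of \<open>V\<close> have norm above \<open>\<rho> + 2 * r\<close>, so a
    centre within \<open>r\<close> of such a point has norm above \<open>\<rho> + r\<close>. This
    leaves only centres admissible as the final \<open>q\<close>.\<close>
  define Q' where "Q' = {q \<in> Q. \<rho> + r < norm q}"
  define \<G> where "\<G> = (\<lambda>q. F \<inter> cball q r) ` Q'"
  define V where "V = F - F \<inter> cball 0 (\<rho> + 2 * r)"
  have "openin T V"
    using cball[of 0 "\<rho> + 2 * r"] by (simp add: closedin_def T_def V_def Diff_Int_distrib)
  have "V \<noteq> {}"
  proof
    assume "V = {}"
    then have "D \<subseteq> cball 0 (\<rho> + 2 * r)" by (intro dominates_hull[OF F(3)]) (auto simp: V_def)
    then show False using x0 \<open>0 < r\<close> by auto
  qed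
  have "V \<subseteq> \<Union>\<G>"
  proof
    fix y assume y: "y \<in> V"
    then have "y \<in> closure Q" using \<open>F \<subseteq> closure Q\<close> by (auto simp: V_def)
    then obtain q where q: "q \<in> Q" "dist q y < r" using \<open>0 < r\<close> by (meson closure_approachable)
    have "norm y \<le> norm q + dist q y" using norm_triangle_ineq3[of q y] by (simp add: dist_norm)
    then have "q \<in> Q'" using y q by (auto simp: V_def Q'_def)
    then show "y \<in> \<Union>\<G>" unfolding \<G>_def using y q by (intro UN_I[of q]) (auto simp: V_def)
  qed
  then have "V \<subseteq> T interior_of \<Union>\<G>" using \<open>openin T V\<close> by (rule interior_of_maximal)
  \<comment> \<open>Baire's theorem in the compact Hausdorff space \<open>T\<close>: countably many
    weakly closed pieces cover the nonempty open set \<open>V\<close>, so one of them has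
    interior.\<close>
  have "\<exists>q\<in>Q'. T interior_of (F \<inter> cball q r) \<noteq> {}"
  proof (rule ccontr)
    assume "\<not> ?thesis"
    then have "T interior_of \<Union>\<G> = {}"
      using Q(1) cball by (intro Baire_category_alt disjI2 Baire) (auto simp: \<G>_def Q'_def)
    then show False using \<open>V \<subseteq> T interior_of \<Union>\<G>\<close> \<open>V \<noteq> {}\<close> by blast
  qed
  then obtain q where q: "\<rho> + r < norm q" "T interior_of (F \<inter> cball q r) \<noteq> {}"
    by (auto simp: Q'_def)
  define W where "W = T interior_of (F \<inter> cball q r)"
  have W: "W \<noteq> {}" "W \<subseteq> F \<inter> cball q r" "openin T W"
    unfolding W_def by (fact q(2) interior_of_subset openin_interior_of)+

  have "closedin T (F - W)" using closedin_diff[OF closedin_topspace W(3)] by (simp add: T_def)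
  then have closed: "closedin weak_real (F - W)"
    using F(2) closedin_trans_full unfolding T_def by blast
  then have compact: "compactin weak_real (F - W)" using F_compact by (blast intro: closed_compactin)
  have "F - W \<noteq> F" using W by blast
  then have "\<not> dominates (F - W) D" using F_min[of "F - W"] closed by blast
  then obtain g :: "'v \<Rightarrow> real" and x1 where g: "bounded_linear g" and x1: "x1 \<in> D"
    and less: "\<And>y. y \<in> F - W \<Longrightarrow> g y < g x1"
    unfolding dominates_def by (meson not_le)
  have "continuous_map weak_real euclidean g"
    using g by (intro continuous_map_weak_topology_dual) (simp add: dual_scaleR)
  then have "compact (g ` (F - W))" using compact image_compactin compactin_euclidean_iff by blast
  \<comment> \<open>Compactness turns the pointwise strict inequality on \<open>F - W\<close> into a
    uniform gap below \<open>g x1\<close>. If \<open>F - W\<close> is empty, any number below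
    \<open>g x1\<close> serves.\<close>
  then obtain \<beta>0 where \<beta>0: "\<beta>0 < g x1" "\<And>y. y \<in> F - W \<Longrightarrow> g y \<le> \<beta>0"
  proof (cases "F - W = {}")
    case True
    then show ?thesis using that[of "g x1 - 1"] by auto
  next
    case False
    then obtain z where "z \<in> F - W" "\<forall>y\<in>F - W. g y \<le> g z"
      using compact_attains_sup[OF \<open>compact (g ` (F - W))\<close>] by auto
    then show ?thesis using less that[of "g z"] by blast
  qed
  define M where "M = (SUP x\<in>D. g x)"
  have bdd: "bdd_above (g ` D)"
    using bounded_linear_image[OF \<open>bounded D\<close> g] by (rule bounded_imp_bdd_above)
  have D_M: "g x \<le> M" if "x \<in> D" for x unfolding M_def using that bdd by (rule cSUP_upper)
  have g_cont: "continuous_on S g" for S using g linear_continuous_on by blast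
  have "K0 \<subseteq> {z. g z \<le> M}"
    using D_M bounded_linear.linear[OF g]
    by (intro K0_min closed_Collect_le g_cont)
       (auto simp: convex_def linear_add linear_cmul intro!: convex_bound_le)
  then have F_M: "g y \<le> M" if "y \<in> F" for y using that F(1) by blast
  have "\<beta>0 < M" using \<beta>0(1) D_M[OF x1] by simp
  obtain b where b: "\<And>z. z \<in> K0 \<Longrightarrow> norm z \<le> b" using \<open>bounded K0\<close> bounded_iff by metis
  \<comment> \<open>Chosen so that \<open>K * (M - \<beta>0)\<close> bounds
    \<open>norm (y - q)\<close> for all \<open>y\<close> in \<open>K0\<close>. Off \<open>W\<close>
    the drop of \<open>g\<close> below \<open>M\<close> then pays for the distance to
    \<open>q\<close>, while on \<open>W\<close> that distance is at most \<open>r\<close>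
    anyway.\<close>
  define K where "K = (\<bar>b\<bar> + norm q) / (M - \<beta>0)"
  have "0 \<le> K" using \<open>\<beta>0 < M\<close> by (simp add: K_def)
  define C where "C = {z. norm (z - q) + K * g z \<le> r + K * M}"
  have "convex C"
  proof (rule convexI)
    fix x y and u v :: real
    assume xy: "x \<in> C" "y \<in> C" and uv: "0 \<le> u" "0 \<le> v" "u + v = 1"
    have "norm (u *\<^sub>R x + v *\<^sub>R y - q) = norm (u *\<^sub>R (x - q) + v *\<^sub>R (y - q))"
      using uv(3) by (simp add: algebra_simps flip: scaleR_add_left)
    also have "\<dots> \<le> u * norm (x - q) + v * norm (y - q)"
      using uv by (intro norm_triangle_le) simp
    finally have "norm (u *\<^sub>R x + v *\<^sub>R y - q) + K * g (u *\<^sub>R x + v *\<^sub>R y)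
        \<le> u * (norm (x - q) + K * g x) + v * (norm (y - q) + K * g y)"
      using bounded_linear.linear[OF g] by (simp add: linear_add linear_cmul algebra_simps)
    also have "\<dots> \<le> r + K * M" using xy uv by (intro convex_bound_le) (auto simp: C_def)
    finally show "u *\<^sub>R x + v *\<^sub>R y \<in> C" by (simp add: C_def)
  qed
  moreover have "closed C" unfolding C_def by (intro closed_Collect_le continuous_intros g_cont)
  moreover have "F \<subseteq> C"
  proof
    fix y assume y: "y \<in> F"
    show "y \<in> C"
    proof (cases "y \<in> W")
      case True
      then have "norm (y - q) \<le> r" using W(2) by (auto simp: dist_norm norm_minus_commute)
      moreover have "K * g y \<le> K * M" using \<open>0 \<le> K\<close> F_M[OF y] by (rule mult_left_mono[rotated])
      ultimately show ?thesis by (simp add: C_def)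
    next
      case False
      have "norm (y - q) \<le> \<bar>b\<bar> + norm q"
        using norm_triangle_ineq4[of y q] b[of y] y F(1) by auto
      also have "\<dots> = K * (M - \<beta>0)" using \<open>\<beta>0 < M\<close> by (simp add: K_def)
      also have "\<dots> \<le> K * (M - g y)" using \<open>0 \<le> K\<close> \<beta>0(2)[of y] y False by (intro mult_left_mono) auto
      finally show ?thesis using \<open>0 < r\<close> by (simp add: C_def algebra_simps)
    qed
  qed
  ultimately have "D \<subseteq> C" using dominates_hull[OF F(3)] by blast
  \<comment> \<open>In \<open>C\<close> one has \<open>norm (x - q) \<le> r + K * (M - g x)\<close>.
    Above the level \<open>\<beta>\<close> the last term is at most \<open>r\<close>; the summand
    \<open>1\<close> covers \<open>K = 0\<close>.\<close>
  define \<beta> where "\<beta> = M - r / (K + 1)"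
  show ?thesis
  proof (intro exI[of _ g] exI[of _ \<beta>] exI[of _ q] conjI ballI impI g q(1))
    have "\<beta> < M" using \<open>0 \<le> K\<close> \<open>0 < r\<close> by (simp add: \<beta>_def)
    then show "\<exists>x\<in>D. \<beta> < g x" unfolding M_def using x1 bdd by (subst (asm) less_cSUP_iff) auto
  next
    fix x assume "x \<in> D" "\<beta> < g x"
    then have "K * (M - g x) \<le> K * (r / (K + 1))"
      using \<open>0 \<le> K\<close> by (intro mult_left_mono) (auto simp: \<beta>_def)
    also have "\<dots> \<le> r"
      using \<open>0 \<le> K\<close> \<open>0 < r\<close> by (simp add: pos_divide_le_eq distrib_left)
    finally show "norm (x - q) \<le> 2 * r" using \<open>D \<subseteq> C\<close> \<open>x \<in> D\<close> by (auto simp: C_def algebra_simps)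
  qed
qed

section \<open>Small slices of relatively weakly compact sets\<close>

text \<open>Convex combinations converging to \<open>x\<close> form a sequence, and each of them
  involves finitely many points of \<open>S\<close>.\<close>

lemma closure_convex_hull_countable_subset:
  fixes S :: "'a::real_normed_vector set"
  assumes "x \<in> closure (convex hull S)"
  obtains A where "countable A" and "A \<subseteq> S" and "x \<in> closure (convex hull A)"
proof -
  obtain u where u: "\<And>n. u n \<in> convex hull S" "u \<longlonglongrightarrow> x"
    using assms unfolding closure_sequential by blast
  have "\<exists>T. finite T \<and> T \<subseteq> S \<and> u n \<in> convex hull T" for n
    using u(1)[of n] unfolding convex_hull_explicit by blast
  then obtain T where T: "\<And>n. finite (T n)" "\<And>n. T n \<subseteq> S" "\<And>n. u n \<in> convex hull (T n)"
    by metis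
  define A where "A = (\<Union>n. T n)"
  have "u n \<in> convex hull A" for n
    using T(3)[of n] hull_mono[of "T n" A] by (auto simp: A_def)
  then have "x \<in> closure (convex hull A)" using u(2) unfolding closure_sequential by blast
  moreover have "countable A" using T(1) by (auto simp: A_def intro: countable_finite)
  moreover have "A \<subseteq> S" using T(2) by (auto simp: A_def)
  ultimately show thesis using that by blast
qed

text \<open>
  If no slice were small, every \<open>x \<in> D\<close> of large norm would lie in the closed convex hull of
  countably many points of \<open>D\<close> far from \<open>x\<close>. Closing up under this choice gives a countable set
  contradicting \<open>countable_small_slice\<close>.
\<close>

lemma weakly_compact_small_slice:
  fixes D :: "'v::banach set"
  assumes H: "compactin weak_real H" and "D \<subseteq> H" and "bounded D"
    and x0: "x0 \<in> D" "\<sigma> < norm x0" and "0 \<le> \<sigma>" and "0 < \<epsilon>"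
  shows "\<exists>(g :: 'v \<Rightarrow> real) \<beta> q. bounded_linear g \<and> \<sigma> < norm q \<and> (\<exists>x\<in>D. \<beta> < g x) \<and>
    (\<forall>x\<in>D. \<beta> < g x \<longrightarrow> norm (x - q) \<le> \<epsilon>)"
proof (rule ccontr)
  assume no_slice: "\<not> ?thesis"
  have "\<exists>A. countable A \<and> A \<subseteq> D - cball x \<epsilon> \<and> x \<in> closure (convex hull A)"
    if x: "x \<in> D" "\<sigma> < norm x" for x
  proof -
    \<comment> \<open>Otherwise a separating functional cuts out a slice of \<open>D\<close> inside
      \<open>cball x \<epsilon>\<close>, which is a small slice with \<open>q = x\<close>.\<close>
    have "x \<in> closure (convex hull (D - cball x \<epsilon>))"
    proof (rule ccontr)
      assume "x \<notin> closure (convex hull (D - cball x \<epsilon>))"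
      then obtain g :: "'v \<Rightarrow> real" and c where g: "bounded_linear g" "c < g x"
          "\<forall>y\<in>closure (convex hull (D - cball x \<epsilon>)). g y \<le> c"
        using separate_point_closed_convex[OF closed_closure convex_closure[OF convex_convex_hull]]
        by blast
      have sub: "D - cball x \<epsilon> \<subseteq> closure (convex hull (D - cball x \<epsilon>))"
        by (rule order_trans[OF hull_subset closure_subset])
      have "norm (y - x) \<le> \<epsilon>" if "y \<in> D" "c < g y" for y
      proof (rule ccontr)
        assume "\<not> ?thesis"
        then have "y \<in> D - cball x \<epsilon>"
          using \<open>y \<in> D\<close> by (auto simp: dist_norm norm_minus_commute)
        then have "g y \<le> c" using g(3) sub by blast
        then show False using \<open>c < g y\<close> by simp
      qed
      then show False using no_slice g(1,2) x by blast
    qed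
    then show ?thesis by (rule closure_convex_hull_countable_subset) blast
  qed
  then obtain A where A: "\<And>x. x \<in> D \<Longrightarrow> \<sigma> < norm x \<Longrightarrow>
      countable (A x) \<and> A x \<subseteq> D - cball x \<epsilon> \<and> x \<in> closure (convex hull (A x))"
    by metis
  define step where "step X = X \<union> (\<Union>x\<in>{x \<in> X. \<sigma> < norm x}. A x)" for X
  define X where "X n = (step ^^ n) {x0}" for n
  have X: "X 0 = {x0}" "X (Suc n) = step (X n)" for n by (simp_all add: X_def)
  have X_D: "X n \<subseteq> D" for n
  proof (induction n)
    case (Suc n)
    then show ?case using A by (fastforce simp: X step_def)
  qed (use x0 in \<open>simp add: X\<close>)
  have "countable (X n)" for n
  proof (induction n)
    case (Suc n)
    then show ?case
      using A X_D[of n] unfolding X step_def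
      by (intro countable_Un countable_UN) (auto intro: countable_subset[OF _ Suc])
  qed (simp add: X)
  then have X_count: "countable (\<Union>n. X n)" by blast
  have X_sub: "(\<Union>n. X n) \<subseteq> D" using X_D by blast
  \<comment> \<open>Points of the slice lie within \<open>2 * r\<close> of \<open>q\<close>, so two
    of them differ by at most \<open>4 * r \<le> \<epsilon>\<close>. The other bound leaves room to
    use the countable case with \<open>\<sigma> + r\<close> as \<open>\<rho>\<close>. Then
    \<open>norm q > \<sigma> + 2 * r\<close>, so every point of the slice has norm above
    \<open>\<sigma>\<close> and the closing-up step applies to it.\<close>
  define r where "r = min (\<epsilon> / 4) ((norm x0 - \<sigma>) / 5)"
  have "0 < r" using x0 \<open>0 < \<epsilon>\<close> by (simp add: r_def)
  moreover have "r \<le> \<epsilon> / 4" "r \<le> (norm x0 - \<sigma>) / 5"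
    unfolding r_def by (rule min.cobounded1 min.cobounded2)+
  ultimately have r: "0 < r" "4 * r \<le> \<epsilon>" and r5: "5 * r \<le> norm x0 - \<sigma>" by simp_all
  have r3: "(\<sigma> + r) + 3 * r < norm x0" using r5 r(1) by linarith
  have x0_X: "x0 \<in> (\<Union>n. X n)" using X(1) by blast
  have nonneg: "0 \<le> \<sigma> + r" using \<open>0 \<le> \<sigma>\<close> r(1) by simp
  obtain g :: "'v \<Rightarrow> real" and \<beta> q where g: "bounded_linear g" "(\<sigma> + r) + r < norm q"
      "\<exists>x\<in>(\<Union>n. X n). \<beta> < g x"
      "\<forall>x\<in>(\<Union>n. X n). \<beta> < g x \<longrightarrow> norm (x - q) \<le> 2 * r"
    using countable_small_slice[OF H order_trans[OF X_sub \<open>D \<subseteq> H\<close>] X_count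
        bounded_subset[OF \<open>bounded D\<close> X_sub] x0_X r3 nonneg r(1)]
    by (elim exE conjE) (rule that)
  obtain n x where x: "x \<in> X n" "\<beta> < g x" using g(3) by blast
  then have "norm (x - q) \<le> 2 * r" using g(4) by blast
  then have "\<sigma> < norm x" using g(2) norm_triangle_ineq2[of q x] by (simp add: norm_minus_commute)
  then have Ax: "A x \<subseteq> D - cball x \<epsilon>" "x \<in> closure (convex hull (A x))" using A x X_D by blast+
  have "A x \<subseteq> X (Suc n)" using x \<open>\<sigma> < norm x\<close> by (auto simp: X step_def)
  \<comment> \<open>Points of \<open>A x\<close> belong to the next stage but are farther than
    \<open>\<epsilon>\<close> from \<open>x\<close>, hence lie outside the slice. Then
    \<open>g \<le> \<beta>\<close> also on their closed convex hull, which contains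
    \<open>x\<close>.\<close>
  have "A x \<subseteq> {z. g z \<le> \<beta>}"
  proof
    fix y assume y: "y \<in> A x"
    show "y \<in> {z. g z \<le> \<beta>}"
    proof (rule ccontr)
      assume "y \<notin> {z. g z \<le> \<beta>}"
      then have "norm (y - q) \<le> 2 * r" using g(4) y \<open>A x \<subseteq> X (Suc n)\<close> by auto
      then have "norm (x - y) \<le> 4 * r"
        using \<open>norm (x - q) \<le> 2 * r\<close> norm_triangle_ineq4[of "x - q" "y - q"] by simp
      then show False using y Ax(1) r(2) by (auto simp: dist_norm)
    qed
  qed
  moreover have "closed {z. g z \<le> \<beta>}"
    using linear_continuous_on[OF g(1)] by (intro closed_Collect_le continuous_intros)
  moreover have "convex {z. g z \<le> \<beta>}"
    using bounded_linear.linear[OF g(1)]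
    by (auto simp: convex_def linear_add linear_cmul intro!: convex_bound_le)
  ultimately have "closure (convex hull (A x)) \<subseteq> {z. g z \<le> \<beta>}"
    by (intro closure_minimal hull_minimal)
  then show False using Ax(2) x(2) by auto
qed

section \<open>Scalars and functionals\<close>

lemma linear_to_complex: "linear (to_complex :: 'k::real_or_complex \<Rightarrow> complex)"
  by (intro linearI) (simp_all add: to_complex_add to_complex_scaleR)

lemmas to_complex_diff = linear_diff[OF linear_to_complex]

lemma to_complex_eq_iff: "to_complex x = to_complex y \<longleftrightarrow> x = y"
  using norm_to_complex[of "x - y"] by (auto simp: to_complex_diff)

lemma to_complex_1 [simp]: "to_complex 1 = 1"
proof -
  have "to_complex (1::'a) * to_complex (1::'a) = to_complex (1::'a) * 1"
    by (simp flip: to_complex_mult)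
  moreover have "to_complex (1::'a) \<noteq> 0" using norm_to_complex[of "1::'a"] by auto
  ultimately show ?thesis by (metis mult_left_cancel)
qed

lemma to_complex_of_real [simp]: "to_complex (of_real r) = of_real r"
  by (simp add: of_real_def to_complex_scaleR)

lemma to_complex_inv:
  "z \<in> range (to_complex :: 'k \<Rightarrow> complex) \<Longrightarrow> to_complex (inv to_complex z :: 'k::real_or_complex) = z"
  by (rule f_inv_into_f)

lemma bounded_linear_re: "bounded_linear (re :: 'k::real_or_complex \<Rightarrow> real)"
proof (rule bounded_linear_intro[where K = 1])
  show "norm (re c) \<le> norm c * 1" for c :: 'k
    using abs_Re_le_cmod[of "to_complex c"] by (simp add: re_def norm_to_complex)
qed (simp_all add: re_def to_complex_add to_complex_scaleR)

lemma re_le_norm: "re c \<le> norm c"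
  using complex_Re_le_cmod[of "to_complex c"] by (simp add: re_def norm_to_complex)

lemma re_of_real [simp]: "re (of_real r) = r"
  by (simp add: re_def)

text \<open>The range of \<open>to_complex\<close> is closed in the plane, and its inverse is an
  isometry carrying the compact unit circle of the range back to the scalars.\<close>

lemma compact_unit_sphere: "compact (sphere (0 :: 'k::real_or_complex) 1)"
proof -
  define R where "R = range (to_complex :: 'k \<Rightarrow> complex)"
  have "closed R"
    unfolding R_def using range_to_complex[where 'a = 'k] closed_complex_Reals by auto
  then have "compact (R \<inter> sphere 0 1)" by (intro closed_Int_compact compact_sphere)
  moreover have "continuous_on (R \<inter> sphere 0 1) (inv to_complex :: complex \<Rightarrow> 'k)"
  proof (rule continuous_on_subset)
    have "dist (inv to_complex z) (inv to_complex w :: 'k) = dist z w" if "z \<in> R" "w \<in> R" for z w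
      using that norm_to_complex[of "inv to_complex z - inv to_complex w :: 'k"]
      by (simp add: to_complex_diff to_complex_inv R_def dist_norm)
    then show "continuous_on R (inv to_complex :: complex \<Rightarrow> 'k)"
      unfolding continuous_on_iff by metis
  qed simp
  ultimately have "compact ((inv to_complex :: complex \<Rightarrow> 'k) ` (R \<inter> sphere 0 1))"
    by (rule compact_continuous_image[rotated])
  also have "(inv to_complex :: complex \<Rightarrow> 'k) ` (R \<inter> sphere 0 1) = sphere 0 1"
  proof -
    have "inj (to_complex :: 'k \<Rightarrow> complex)" by (simp add: inj_def to_complex_eq_iff)
    then have "c = inv to_complex (to_complex c)" for c :: 'k by simp
    moreover have "norm (inv to_complex z :: 'k) = cmod z" if "z \<in> R" for z
      using that norm_to_complex[of "inv to_complex z :: 'k"] by (simp add: R_def to_complex_inv)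
    ultimately show ?thesis by (force simp: R_def norm_to_complex)
  qed
  finally show ?thesis .
qed

section \<open>Real functionals as real parts, and circled hulls\<close>

context banach_space_over
begin

lemma smul_of_real_add_mult:
  "smul (of_real a + of_real b * i) x = a *\<^sub>R x + b *\<^sub>R smul i x"
  by (simp add: scale_left_distrib scale_of_real flip: scale_scale)

lemma bounded_linear_smul: "bounded_linear (smul c)"
proof (rule bounded_linear_intro[where K = "norm c"])
  show "smul c (r *\<^sub>R x) = r *\<^sub>R smul c x" for r x
    by (simp add: mult.commute flip: scale_of_real)
qed (simp_all add: scale_right_distrib norm_scale mult.commute)

lemma dual_of_linear:
  assumes add: "\<And>x y. f (x + y) = f x + f y" and scale: "\<And>c x. f (smul c x) = c * f x"
    and bound: "\<And>x. norm (f x) \<le> norm x * B"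
  shows "f \<in> dual smul"
proof -
  have "f (r *\<^sub>R x) = r *\<^sub>R f x" for r x
    using scale[of "of_real r" x] by (simp add: scale_of_real scaleR_conv_of_real)
  then have "bounded_linear f" using add bound by (intro bounded_linear_intro[where K = B])
  then show ?thesis using scale by (simp add: dual_def)
qed

text \<open>Over the complex numbers the extension is \<open>f x = g x - \<i> g (\<i> x)\<close>.\<close>

lemma dual_with_real_part:
  fixes g :: "'v \<Rightarrow> real"
  assumes g: "bounded_linear g"
  obtains f where "f \<in> dual smul" and "\<And>x. re (f x) = g x"
proof -
  note lin = linear_add[OF bounded_linear.linear[OF g]] linear_cmul[OF bounded_linear.linear[OF g]]
    linear_neg[OF bounded_linear.linear[OF g]]
  obtain B where B: "\<And>x. \<bar>g x\<bar> \<le> norm x * B" using bounded_linear.bounded[OF g] by auto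
  have "\<exists>f\<in>dual smul. \<forall>x. re (f x) = g x"
    using range_to_complex[where 'a = 'k]
  proof
    assume range: "range (to_complex :: 'k \<Rightarrow> complex) = \<real>"
    define f where "f x = (of_real (g x) :: 'k)" for x
    have "f \<in> dual smul"
    proof (rule dual_of_linear[where B = B])
      fix c :: 'k and x
      have "to_complex c \<in> \<real>" unfolding range[symmetric] by (rule rangeI)
      then obtain a where "to_complex c = of_real a" by (auto elim: Reals_cases)
      then have "to_complex c = to_complex (of_real a :: 'k)" by simp
      then have "c = of_real a" by (simp only: to_complex_eq_iff)
      then show "f (smul c x) = c * f x" by (simp add: f_def scale_of_real lin)
    qed (simp_all add: f_def lin B)
    moreover have "re (f x) = g x" for x by (simp add: f_def)
    ultimately show ?thesis by blast
  next
    assume range: "range (to_complex :: 'k \<Rightarrow> complex) = UNIV"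
    then obtain i :: 'k where i: "to_complex i = \<i>" by (metis UNIV_I imageE)
    have "to_complex (i * i) = to_complex (- 1 :: 'k)"
      by (simp add: to_complex_mult i linear_neg[OF linear_to_complex])
    then have "i * i = - 1" by (simp only: to_complex_eq_iff)
    then have ii: "smul i (smul i x) = - x" for x by simp
    define f where "f x = (inv to_complex (Complex (g x) (- g (smul i x))) :: 'k)" for x
    have f: "to_complex (f x) = Complex (g x) (- g (smul i x))" for x
      by (simp add: f_def to_complex_inv range)
    have "f \<in> dual smul"
    proof (rule dual_of_linear[where B = "B + norm i * B"])
      fix x y
      have "to_complex (f (x + y)) = to_complex (f x + f y)"
        by (simp add: f to_complex_add scale_right_distrib lin complex_eq_iff)
      then show "f (x + y) = f x + f y" by (simp only: to_complex_eq_iff)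
    next
      fix c :: 'k and x
      define a b where "a = Re (to_complex c)" and "b = Im (to_complex c)"
      have "to_complex c = to_complex (of_real a + of_real b * i)"
        by (simp add: to_complex_add to_complex_mult i a_def b_def complex_eq_iff)
      then have c: "c = of_real a + of_real b * i" by (simp only: to_complex_eq_iff)
      have "smul i (smul c x) = a *\<^sub>R smul i x - b *\<^sub>R x"
        unfolding c smul_of_real_add_mult scale_right_distrib
          linear_cmul[OF bounded_linear.linear[OF bounded_linear_smul]] ii by simp
      then have "g (smul i (smul c x)) = a * g (smul i x) - b * g x"
        using lin(1)[of "a *\<^sub>R smul i x" "- (b *\<^sub>R x)"] by (simp add: lin)
      moreover have "g (smul c x) = a * g x + b * g (smul i x)"
        unfolding c smul_of_real_add_mult by (simp add: lin)
      ultimately have "to_complex (f (smul c x)) = to_complex (c * f x)"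
        by (simp add: f to_complex_mult complex_eq_iff flip: a_def b_def)
      then show "f (smul c x) = c * f x" by (simp only: to_complex_eq_iff)
    next
      fix x
      have "norm (f x) = cmod (Complex (g x) (- g (smul i x)))" by (metis f norm_to_complex)
      also have "\<dots> \<le> \<bar>g x\<bar> + \<bar>g (smul i x)\<bar>" using cmod_le[of "Complex (g x) (- g (smul i x))"] by simp
      also have "\<dots> \<le> norm x * (B + norm i * B)"
        using B[of x] B[of "smul i x"] by (simp add: norm_scale algebra_simps)
      finally show "norm (f x) \<le> norm x * (B + norm i * B)" .
    qed
    moreover have "re (f x) = g x" for x by (simp add: re_def f)
    ultimately show ?thesis by blast
  qed
  then show thesis using that by blast
qed

text \<open>The hull is the image of a compact product under scalar multiplication, which is jointly
  continuous into the weak topology: \<open>g (smul \<omega> y) = re (\<omega> * f y)\<close> if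
  \<open>f\<close> has real part \<open>g\<close>. The same identity leads from the weak topology
  over the scalar field to the real one.\<close>

lemma compactin_circled_hull:
  assumes "compactin (weak_topology smul) E"
  shows "compactin weak_real ((\<lambda>(\<omega>, y). smul \<omega> y) ` (sphere 0 1 \<times> E))"
proof (rule image_compactin)
  show "compactin (prod_topology (euclidean :: 'k topology) (weak_topology smul)) (sphere 0 1 \<times> E)"
    using assms by (simp add: compactin_Times compact_unit_sphere)
  show "continuous_map (prod_topology (euclidean :: 'k topology) (weak_topology smul)) weak_real (\<lambda>(\<omega>, y). smul \<omega> y)"
  proof (rule continuous_map_into_weak_topology)
    fix g :: "'v \<Rightarrow> real" assume "g \<in> dual scaleR"
    then have "bounded_linear g" by (simp add: dual_scaleR)
    then obtain f where f: "f \<in> dual smul" "\<And>x. re (f x) = g x" using dual_with_real_part by blast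
    let ?P = "prod_topology (euclidean :: 'k topology) (weak_topology smul)"
    have "continuous_map ?P euclidean (\<lambda>p. f (snd p))"
      using continuous_map_compose[OF continuous_map_snd continuous_map_weak_topology_dual[OF f(1)]]
      by (simp add: comp_def)
    then have "continuous_map ?P euclidean (\<lambda>p. fst p * f (snd p))"
      using continuous_map_fst[of "euclidean :: 'k topology" "weak_topology smul"]
      unfolding continuous_map_atin limitin_canonical_iff by (auto intro!: tendsto_mult)
    moreover have "continuous_map euclidean euclidean (re :: 'k \<Rightarrow> real)"
      using linear_continuous_on[OF bounded_linear_re] by simp
    ultimately have "continuous_map ?P euclidean (\<lambda>p. re (fst p * f (snd p)))"
      using continuous_map_compose[of ?P euclidean "\<lambda>p. fst p * f (snd p)" euclidean re]
      by (simp add: comp_def)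
    moreover have "g \<circ> (\<lambda>(\<omega>, y). smul \<omega> y) = (\<lambda>p. re (fst p * f (snd p)))"
      using f(1) by (auto simp: dual_def fun_eq_iff simp flip: f(2))
    ultimately show "continuous_map ?P euclidean (g \<circ> (\<lambda>(\<omega>, y). smul \<omega> y))" by simp
  qed
qed

end

section \<open>The Daugavet equation\<close>

lemma norm_le_supnorm:
  assumes "bounded (\<Theta> ` cball 0 1)" and "x \<in> cball 0 1"
  shows "norm (\<Theta> x) \<le> supnorm \<Theta>"
proof -
  have "bdd_above ((\<lambda>x. norm (\<Theta> x)) ` cball 0 1)"
    using assms(1) by (auto simp: bounded_iff bdd_above_def)
  then show ?thesis unfolding supnorm_def using assms(2) by (intro cSUP_upper)
qed

lemma supnorm_le:
  fixes \<Theta> :: "'x::real_normed_vector \<Rightarrow> 'v::real_normed_vector"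
  assumes "\<And>x. x \<in> cball 0 1 \<Longrightarrow> norm (\<Theta> x) \<le> c"
  shows "supnorm \<Theta> \<le> c"
  unfolding supnorm_def using assms by (intro cSUP_least) auto

lemma less_supnormD:
  fixes \<Theta> :: "'x::real_normed_vector \<Rightarrow> 'v::real_normed_vector"
  assumes "c < supnorm \<Theta>"
  obtains x where "x \<in> cball 0 1" and "c < norm (\<Theta> x)"
  using supnorm_le[of \<Theta> c] assms by (meson not_le)

section \<open>Slices of the maps and the lower bound for the sum\<close>

context banach_space_over
begin

text \<open>One \<open>q\<close> serves all rotations \<open>\<omega>\<close>, because the small
  slice is found in the circled set \<open>D\<close>. The level of that slice becomes a level for
  the normalized \<open>f \<circ> \<Psi>\<close>, to which strong slice continuity applies.\<close>

lemma slice_with_almost_constant_values: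
  fixes \<Upsilon> \<Psi> :: "'x::real_normed_vector \<Rightarrow> 'v"
  assumes \<Psi>: "\<Psi> \<in> linf_ball" "supnorm \<Psi> = 1"
    and ssc: "strongly_slice_continuous smul \<Psi> \<Upsilon>"
    and wc: "weakly_compact_map smul \<Psi>"
    and \<epsilon>: "0 < \<epsilon>" "\<epsilon> < 1 / 2"
  obtains h \<mu> q where "h \<in> dual smul" and "nonzero_on_ball (h \<circ> \<Upsilon>)" and "0 < \<mu>"
    and "\<bar>norm q - 1\<bar> \<le> \<epsilon>"
    and "\<And>\<omega> x. \<omega> \<in> sphere 0 1 \<Longrightarrow> x \<in> slice (\<lambda>x. \<omega> * normalized_comp h \<Upsilon> x) \<mu> \<Longrightarrow>
      norm (smul \<omega> (\<Psi> x) - q) \<le> \<epsilon>"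
proof -
  define E where "E = weak_topology smul closure_of (\<Psi> ` cball 0 1)"
  define H where "H = (\<lambda>(\<omega>, y). smul \<omega> y) ` (sphere 0 1 \<times> E)"
  define D where "D = (\<lambda>(\<omega>, x). smul \<omega> (\<Psi> x)) ` (sphere 0 1 \<times> cball 0 1)"
  have H: "compactin weak_real H"
    unfolding H_def E_def using wc by (intro compactin_circled_hull) (simp add: weakly_compact_map_def)
  have "\<Psi> ` cball 0 1 \<subseteq> E" unfolding E_def by (intro closure_of_subset) simp
  then have "D \<subseteq> H" unfolding D_def H_def by fastforce
  have \<Psi>_le: "norm (\<Psi> x) \<le> 1" if "x \<in> cball 0 1" for x
    using norm_le_supnorm[OF _ that, of \<Psi>] \<Psi> by (simp add: linf_ball_def)
  have D_le: "norm z \<le> 1" if "z \<in> D" for z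
    using that \<Psi>_le by (auto simp: D_def norm_scale)
  then have "bounded D" unfolding bounded_iff by blast
  obtain x0 where x0: "x0 \<in> cball 0 1" "1 - \<epsilon> < norm (\<Psi> x0)"
    using less_supnormD[of "1 - \<epsilon>" \<Psi>] \<Psi>(2) \<epsilon> by auto
  have "\<Psi> x0 \<in> D" unfolding D_def using x0(1) by (intro image_eqI[of _ _ "(1, x0)"]) auto
  then obtain g :: "'v \<Rightarrow> real" and \<beta> q where g: "bounded_linear g" and q: "1 - \<epsilon> < norm q"
    and "\<exists>z\<in>D. \<beta> < g z" and small: "\<forall>z\<in>D. \<beta> < g z \<longrightarrow> norm (z - q) \<le> \<epsilon>"
    using weakly_compact_small_slice[OF H \<open>D \<subseteq> H\<close> \<open>bounded D\<close> _ x0(2) _ \<epsilon>(1)] \<epsilon>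
    by auto
  then obtain z where z: "z \<in> D" "\<beta> < g z" by blast
  have "norm q \<le> norm z + norm (z - q)" using norm_triangle_ineq3[of z q] by simp
  then have q_norm: "\<bar>norm q - 1\<bar> \<le> \<epsilon>" using q D_le[OF z(1)] small z by fastforce
  obtain f where f: "f \<in> dual smul" "\<And>x. re (f x) = g x" using dual_with_real_part[OF g] by blast
  have f_lin: "f (smul c x) = c * f x" for c x using f(1) by (simp add: dual_def)
  define \<gamma> where "\<gamma> = max \<beta> 0"
  \<comment> \<open>The level can be raised to a nonnegative one. Otherwise \<open>g \<le> 0\<close>
    on the symmetric set \<open>D\<close> and \<open>\<beta> < 0\<close>, so \<open>g\<close>
    vanishes at \<open>z\<close> and \<open>- z\<close>. Both are then within
    \<open>\<epsilon>\<close> of \<open>q\<close>, which forces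
    \<open>norm q \<le> \<epsilon>\<close>.\<close>
  have "\<exists>z\<in>D. \<gamma> < g z"
  proof (rule ccontr)
    assume "\<not> ?thesis"
    then have le: "g w \<le> \<gamma>" if "w \<in> D" for w using that by (meson not_le)
    then have "\<gamma> = 0" "\<beta> < 0" using z(2) le[OF z(1)] by (simp_all add: \<gamma>_def max_def split: if_splits)
    obtain \<omega> x where z_eq: "z = smul \<omega> (\<Psi> x)" "norm \<omega> = 1" "x \<in> cball 0 1"
      using z(1) by (auto simp: D_def)
    have "- z \<in> D" unfolding D_def using z_eq by (intro image_eqI[of _ _ "(- \<omega>, x)"]) auto
    then have "g z = 0" "g (- z) = 0"
      using le[of z] le[of "- z"] z(1) \<open>\<gamma> = 0\<close> linear_neg[OF bounded_linear.linear[OF g], of z]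
      by auto
    then have "norm (z - q) \<le> \<epsilon>" "norm (- z - q) \<le> \<epsilon>"
      using small z(1) \<open>- z \<in> D\<close> \<open>\<beta> < 0\<close> by auto
    moreover have "2 * norm q \<le> norm (z - q) + norm (- z - q)"
      using norm_triangle_ineq[of "z - q" "- z - q"] by (simp add: norm_minus_commute flip: scaleR_2)
    ultimately show False using q \<epsilon> by linarith
  qed
  then obtain w where w: "w \<in> D" "\<gamma> < g w" by blast
  define N where "N = supnorm (f \<circ> \<Psi>)"
  have "bounded_linear f" using f(1) by (simp add: dual_def)
  then have "bounded ((f \<circ> \<Psi>) ` cball 0 1)"
    using bounded_linear_image[of "\<Psi> ` cball 0 1" f] \<Psi>(1) by (simp add: linf_ball_def image_comp)
  note f_le = norm_le_supnorm[OF this, folded N_def]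
  obtain \<omega>1 x1 where w_eq: "w = smul \<omega>1 (\<Psi> x1)" "norm \<omega>1 = 1" "x1 \<in> cball 0 1"
    using w(1) by (auto simp: D_def)
  have "g w = re (\<omega>1 * f (\<Psi> x1))" using f(2)[of w] by (simp add: w_eq f_lin)
  also have "\<dots> \<le> norm (f (\<Psi> x1))" using re_le_norm[of "\<omega>1 * f (\<Psi> x1)"] w_eq(2) by (simp add: norm_mult)
  finally have less: "\<gamma> < norm (f (\<Psi> x1))" using w(2) by simp
  then have "nonzero_on_ball (f \<circ> \<Psi>)" using w_eq(3) by (auto simp: nonzero_on_ball_def \<gamma>_def)
  have N: "\<gamma> < N" "0 \<le> \<gamma>" using less f_le[OF w_eq(3)] by (simp, simp add: \<gamma>_def)
  \<comment> \<open>Makes \<open>(1 - \<delta>) * N\<close> the midpoint of \<open>\<gamma>\<close>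
    and \<open>N\<close>.\<close>
  define \<delta> where "\<delta> = (1 - \<gamma> / N) / 2"
  have \<delta>: "0 < \<delta>" "\<delta> < 1" "\<gamma> < (1 - \<delta>) * N" using N by (auto simp: \<delta>_def field_simps)
  obtain h \<mu> where h: "h \<in> dual smul" "nonzero_on_ball (h \<circ> \<Upsilon>)" "0 < \<mu>"
    "\<forall>\<omega>\<in>sphere 0 1. slice (\<lambda>x. \<omega> * normalized_comp h \<Upsilon> x) \<mu>
      \<subseteq> slice (\<lambda>x. \<omega> * normalized_comp f \<Psi> x) \<delta>"
    using ssc f(1) \<open>nonzero_on_ball (f \<circ> \<Psi>)\<close> \<delta>(1,2) unfolding strongly_slice_continuous_def by blast
  show thesis
  proof (rule that[OF h(1-3) q_norm])
    fix \<omega> x assume \<omega>: "\<omega> \<in> sphere (0 :: 'k) 1"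
      and "x \<in> slice (\<lambda>x. \<omega> * normalized_comp h \<Upsilon> x) \<mu>"
    then have x: "x \<in> cball 0 1" "1 - \<delta> \<le> re (\<omega> * normalized_comp f \<Psi> x)"
      using h(4) by (auto simp: slice_def)
    have "re (\<omega> * normalized_comp f \<Psi> x) = g (smul \<omega> (\<Psi> x)) / N"
      using bounded_linear.linear[OF bounded_linear_re, THEN linear_cmul, of "1 / N" "\<omega> * f (\<Psi> x)"]
      by (simp add: normalized_comp_def f_lin flip: N_def f(2))
    then have "(1 - \<delta>) * N \<le> g (smul \<omega> (\<Psi> x))"
      using x(2) N by (simp add: pos_le_divide_eq)
    then have "\<beta> < g (smul \<omega> (\<Psi> x))" using \<delta>(3) by (simp add: \<gamma>_def)
    moreover have "smul \<omega> (\<Psi> x) \<in> D" unfolding D_def using \<omega> x(1) by (intro image_eqI[of _ _ "(\<omega>, x)"]) auto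
    ultimately show "norm (smul \<omega> (\<Psi> x) - q) \<le> \<epsilon>" using small by blast
  qed
qed

text \<open>At most \<open>\<epsilon>\<close> is lost in each of four places: the choice of a nearly
  norming \<open>x\<close>, the modulus of \<open>a x\<close> against \<open>1\<close>, the
  normalization of \<open>q\<close>, and the values of \<open>\<Psi>\<close> on the slice.\<close>

lemma supnorm_add_ge:
  fixes \<Phi> \<Upsilon> \<Psi> :: "'x::real_normed_vector \<Rightarrow> 'v"
  assumes \<Phi>: "\<Phi> \<in> linf_ball" "supnorm \<Phi> = 1" and \<Upsilon>: "\<Upsilon> \<in> linf_ball"
    and \<Psi>: "\<Psi> \<in> linf_ball" "supnorm \<Psi> = 1"
    and daugavet: "daugavet_wrt \<Phi> (rank_one_maps smul \<Upsilon>)"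
    and ssc: "strongly_slice_continuous smul \<Psi> \<Upsilon>"
    and wc: "weakly_compact_map smul \<Psi>"
    and \<epsilon>: "0 < \<epsilon>" "\<epsilon> < 1 / 2"
  shows "2 - 4 * \<epsilon> \<le> supnorm (\<lambda>x. \<Phi> x + \<Psi> x)"
proof -
  obtain h \<mu> q where h: "h \<in> dual smul" "nonzero_on_ball (h \<circ> \<Upsilon>)" and \<mu>: "0 < \<mu>"
    and q: "\<bar>norm q - 1\<bar> \<le> \<epsilon>"
    and near: "\<And>\<omega> x. \<omega> \<in> sphere 0 1 \<Longrightarrow> x \<in> slice (\<lambda>x. \<omega> * normalized_comp h \<Upsilon> x) \<mu> \<Longrightarrow>
      norm (smul \<omega> (\<Psi> x) - q) \<le> \<epsilon>"
    using slice_with_almost_constant_values[OF \<Psi> ssc wc \<epsilon>] by metis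
  have "q \<noteq> 0" using q \<epsilon> by auto
  \<comment> \<open>A unit vector in place of \<open>q\<close> gives
    \<open>norm (\<Theta> x) = norm (a x)\<close> exactly.\<close>
  define u where "u = (1 / norm q) *\<^sub>R q"
  have u: "norm u = 1" using \<open>q \<noteq> 0\<close> by (simp add: u_def)
  have "u - q = (1 / norm q - 1) *\<^sub>R q" by (simp add: u_def scaleR_left_diff_distrib)
  then have "norm (u - q) = \<bar>(1 / norm q - 1) * norm q\<bar>" by (simp add: abs_mult)
  also have "(1 / norm q - 1) * norm q = 1 - norm q"
    using \<open>q \<noteq> 0\<close> by (simp add: left_diff_distrib)
  finally have u_q: "norm (u - q) \<le> \<epsilon>" using q by simp

  define N where "N = supnorm (h \<circ> \<Upsilon>)"
  have "bounded_linear h" using h(1) by (simp add: dual_def)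
  then have "bounded ((h \<circ> \<Upsilon>) ` cball 0 1)"
    using bounded_linear_image[of "\<Upsilon> ` cball 0 1" h] \<Upsilon> by (simp add: linf_ball_def image_comp)
  note h_le = norm_le_supnorm[OF this, folded N_def]
  obtain x0 where x0: "x0 \<in> cball 0 1" "h (\<Upsilon> x0) \<noteq> 0" using h(2) by (auto simp: nonzero_on_ball_def)
  have N: "0 < N" using h_le[OF x0(1)] x0(2) by (simp add: less_le_trans[of 0 "norm (h (\<Upsilon> x0))"])
  define a where "a x = normalized_comp h \<Upsilon> x" for x
  have norm_a: "norm (a x) = norm (h (\<Upsilon> x)) / N" for x
    using N by (simp add: a_def normalized_comp_def flip: N_def)
  have a_le: "norm (a x) \<le> 1" if "x \<in> cball 0 1" for x
    using h_le[OF that] N by (simp add: norm_a)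
  define \<Theta> where "\<Theta> x = smul (a x) u" for x
  have norm_\<Theta>: "norm (\<Theta> x) = norm (a x)" for x by (simp add: \<Theta>_def norm_scale u)
  \<comment> \<open>Moving the factor \<open>1 / N\<close> into the vector exhibits
    \<open>\<Theta>\<close> as a rank one map.\<close>
  have "\<Theta> x = smul (h (\<Upsilon> x)) ((1 / N) *\<^sub>R u)" for x
  proof -
    have "a x = h (\<Upsilon> x) * of_real (1 / N)"
      by (simp add: a_def normalized_comp_def N_def scaleR_conv_of_real mult.commute)
    then show ?thesis unfolding \<Theta>_def by (simp only: scale_of_real flip: scale_scale)
  qed
  then have "\<Theta> \<in> rank_one_maps smul \<Upsilon>" unfolding rank_one_maps_def using h(1) by blast
  then have sum: "supnorm (\<lambda>x. \<Phi> x + \<Theta> x) = 1 + supnorm \<Theta>"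
    using daugavet \<Phi>(2) by (simp add: daugavet_wrt_def)
  have bounded: "bounded (\<Theta> ` cball 0 1)"
    unfolding bounded_iff using a_le by (auto simp: norm_\<Theta> intro!: exI[of _ 1])
  have "N \<le> N * supnorm \<Theta>"
    unfolding N_def
  proof (rule supnorm_le)
    fix x :: 'x assume "x \<in> cball 0 1"
    then have "norm (h (\<Upsilon> x)) / N \<le> supnorm \<Theta>"
      using norm_le_supnorm[OF bounded] by (simp add: norm_\<Theta> norm_a)
    then show "norm ((h \<circ> \<Upsilon>) x) \<le> supnorm (h \<circ> \<Upsilon>) * supnorm \<Theta>"
      using N by (simp add: field_simps flip: N_def)
  qed
  then have "1 \<le> supnorm \<Theta>" using N by simp
  \<comment> \<open>The bound by \<open>\<mu>\<close> puts \<open>x\<close> into the slice; the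
    bound by \<open>\<epsilon>\<close> enters the final estimate.\<close>
  define \<delta> where "\<delta> = min \<mu> \<epsilon>"
  have \<delta>: "0 < \<delta>" "\<delta> \<le> \<mu>" "\<delta> \<le> \<epsilon>" using \<mu> \<epsilon> by (auto simp: \<delta>_def)
  obtain x where x: "x \<in> cball 0 1" and large: "2 - \<delta> < norm (\<Phi> x + \<Theta> x)"
    using less_supnormD[of "2 - \<delta>" "\<lambda>x. \<Phi> x + \<Theta> x"] sum \<open>1 \<le> supnorm \<Theta>\<close> \<delta>(1) by auto
  have \<Phi>_le: "norm (\<Phi> y) \<le> 1" and \<Psi>_le: "norm (\<Psi> y) \<le> 1" if "y \<in> cball 0 1" for y
    using norm_le_supnorm[OF _ that, of \<Phi>] norm_le_supnorm[OF _ that, of \<Psi>] \<Phi> \<Psi>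
    by (simp_all add: linf_ball_def)
  have a_ge: "1 - \<delta> < norm (a x)"
    using large norm_triangle_ineq[of "\<Phi> x" "\<Theta> x"] \<Phi>_le[OF x] by (simp add: norm_\<Theta>)
  then have "a x \<noteq> 0" using \<delta> \<epsilon> by auto
  \<comment> \<open>The rotation that makes \<open>\<omega> * a x\<close> real and positive, so that
    its real part is its modulus, which exceeds \<open>1 - \<delta>\<close>.\<close>
  define \<omega> where "\<omega> = of_real (norm (a x)) / a x"
  have \<omega>: "norm \<omega> = 1" "\<omega> * a x = of_real (norm (a x))"
    using \<open>a x \<noteq> 0\<close> by (simp_all add: \<omega>_def norm_divide)
  have "x \<in> slice (\<lambda>x. \<omega> * normalized_comp h \<Upsilon> x) \<mu>"
    using x a_ge \<delta>(2) \<omega>(2) by (simp add: slice_def flip: a_def)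
  then have \<Psi>_q: "norm (smul \<omega> (\<Psi> x) - q) \<le> \<epsilon>" using \<omega>(1) by (intro near) auto
  have "norm (\<Theta> x - \<Psi> x) = norm (smul \<omega> (\<Theta> x - \<Psi> x))" by (simp add: norm_scale \<omega>(1))
  also have "smul \<omega> (\<Theta> x - \<Psi> x) = smul (\<omega> * a x) u - smul \<omega> (\<Psi> x)"
    by (simp add: \<Theta>_def scale_right_diff_distrib)
  \<comment> \<open>The three differences are the error in the modulus, the normalization error and
    the oscillation of \<open>\<Psi>\<close> on the slice.\<close>
  also have "\<dots> = (norm (a x) *\<^sub>R u - u) + ((u - q) - (smul \<omega> (\<Psi> x) - q))"
    by (simp add: \<omega>(2) scale_of_real)
  also have "norm \<dots> \<le> norm (norm (a x) *\<^sub>R u - u) + (norm (u - q) + norm (smul \<omega> (\<Psi> x) - q))"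
    by (intro norm_triangle_mono norm_triangle_ineq4 order_refl)
  also have "norm (norm (a x) *\<^sub>R u - u) = \<bar>norm (a x) - 1\<bar>"
  proof -
    have "norm (a x) *\<^sub>R u - u = (norm (a x) - 1) *\<^sub>R u" by (simp add: scaleR_left_diff_distrib)
    then show ?thesis by (simp add: u)
  qed
  also have "\<bar>norm (a x) - 1\<bar> \<le> \<epsilon>" using a_le[OF x] a_ge \<delta>(3) by simp
  finally have "norm (\<Theta> x - \<Psi> x) \<le> 3 * \<epsilon>" using u_q \<Psi>_q by simp
  moreover have "norm (\<Phi> x + \<Theta> x) \<le> norm (\<Phi> x + \<Psi> x) + norm (\<Theta> x - \<Psi> x)"
    using norm_triangle_ineq[of "\<Phi> x + \<Psi> x" "\<Theta> x - \<Psi> x"] by simp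
  ultimately have "2 - 4 * \<epsilon> \<le> norm (\<Phi> x + \<Psi> x)" using large \<delta>(3) by simp
  also have "bounded ((\<lambda>x. \<Phi> x + \<Psi> x) ` cball 0 1)"
    unfolding bounded_iff using norm_triangle_mono[OF \<Phi>_le \<Psi>_le] by blast
  then have "norm (\<Phi> x + \<Psi> x) \<le> supnorm (\<lambda>x. \<Phi> x + \<Psi> x)" using x by (rule norm_le_supnorm)
  finally show ?thesis .
qed

end

theorem theorem3p11:
  fixes scaleX :: "'k::real_or_complex \<Rightarrow> 'x::banach \<Rightarrow> 'x"
    and scaleY :: "'k \<Rightarrow> 'y::banach \<Rightarrow> 'y"
    and \<Phi> \<Upsilon> \<Psi> :: "'x \<Rightarrow> 'y"
  assumes "banach_space_over scaleX" and "banach_space_over scaleY"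
    and "\<Phi> \<in> linf_ball" and "\<Upsilon> \<in> linf_ball" and "\<Psi> \<in> linf_ball"
    and "supnorm \<Phi> = 1" and "supnorm \<Upsilon> = 1" and "supnorm \<Psi> = 1"
    and "daugavet_wrt \<Phi> (rank_one_maps scaleY \<Upsilon>)"
    and "strongly_slice_continuous scaleY \<Psi> \<Upsilon>"
    and "weakly_compact_map scaleY \<Psi>"
  shows "supnorm (\<lambda>x. \<Phi> x + \<Psi> x) = 2"
proof (rule antisym)
  show "supnorm (\<lambda>x. \<Phi> x + \<Psi> x) \<le> 2"
  proof (rule supnorm_le)
    fix x :: 'x assume "x \<in> cball 0 1"
    then have "norm (\<Phi> x) \<le> 1" "norm (\<Psi> x) \<le> 1"
      using norm_le_supnorm[of \<Phi> x] norm_le_supnorm[of \<Psi> x] assms by (simp_all add: linf_ball_def)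
    then show "norm (\<Phi> x + \<Psi> x) \<le> 2" using norm_triangle_ineq[of "\<Phi> x" "\<Psi> x"] by simp
  qed
  show "2 \<le> supnorm (\<lambda>x. \<Phi> x + \<Psi> x)"
  proof (rule field_le_epsilon)
    fix e :: real assume "0 < e"
    \<comment> \<open>The first bound absorbs the loss \<open>4 * \<epsilon>\<close> into
      \<open>e\<close>; the second secures \<open>\<epsilon> < 1 / 2\<close>.\<close>
    define \<epsilon> where "\<epsilon> = min (e / 4) (1 / 3)"
    have "0 < \<epsilon>" "\<epsilon> < 1 / 2" "4 * \<epsilon> \<le> e" using \<open>0 < e\<close> by (auto simp: \<epsilon>_def min_def)
    then show "2 \<le> supnorm (\<lambda>x. \<Phi> x + \<Psi> x) + e"
      using banach_space_over.supnorm_add_ge[OF assms(2,3,6,4,5,8-11), of \<epsilon>] by linarith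
  qed
qed

end
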